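(* Let $F$ be a field of characteristic not $2$ with algebraic closure $\overline F$, let $L\subseteq\overline F$ with $L/F$ a biquadratic extension, and let $\alpha\in L$ be a biquadratic generator with minimal polynomial $P(X)=X^4+uX^2+w$ over $F$. Then: \begin{enumerate} \item $L/F$ admits the trivial elementary abelian closure $F$ if and only if $w\in F^2$; \item if $L/F$ admits an elementary abelian closure $E$, then $E=F(\eta)$ for some $\eta\in\overline F$ with $\eta^2=w$; \item $L/F$ admits an elementary abelian closure if and only if $L/F$ is not cyclic. \end{enumerate}
   Context: $F$ is a field of characteristic different from $2$; all extensions lie in $\overline F$ and composita are taken there. A quartic extension is biquadratic if it has a primitive element (biquadratic generator) with minimal polynomial $X^4+uX^2+w$, $u,w\in F$. A quartic extension is cyclic if it is Galois with group $\mathbb{Z}/4\mathbb{Z}$, and elementary abelian if it is Galois with group $\mathbb{Z}/2\mathbb{Z}\times\mathbb{Z}/2\mathbb{Z}$. An elementary abelian closure of a degree-$n$ extension $L/F$ is an extension $K/F$ of smallest degree such that $LK/K$ is an elementary abelian extension of degree $n$. *)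

theory Defs
  imports "HOL-Algebra.Algebra" "HOL-Library.Extended_Nat"
begin

text \<open>
  All fields are subfields of one ambient field \<open>R\<close>, which the theorem takes to be an algebraic
  closure of the base field. In the relations below the base field comes before the extension.
\<close>

definition field_ext :: "('a, 'b) ring_scheme \<Rightarrow> 'a set \<Rightarrow> 'a set \<Rightarrow> bool" where
  "field_ext R F L \<longleftrightarrow> subfield F R \<and> subfield L R \<and> F \<subseteq> L"

definition ext_degree :: "('a, 'b) ring_scheme \<Rightarrow> 'a set \<Rightarrow> 'a set \<Rightarrow> enat" where
  "ext_degree R F L =
     (if ring.finite_dimension R F L then enat (ring.dim R F L) else \<infinity>)"

definition quartic_ext :: "('a, 'b) ring_scheme \<Rightarrow> 'a set \<Rightarrow> 'a set \<Rightarrow> bool" where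
  "quartic_ext R F L \<longleftrightarrow> field_ext R F L \<and> ext_degree R F L = 4"

definition adjoin :: "('a, 'b) ring_scheme \<Rightarrow> 'a set \<Rightarrow> 'a \<Rightarrow> 'a set" where
  "adjoin R F x = generate_field R (insert x F)"

definition compositum :: "('a, 'b) ring_scheme \<Rightarrow> 'a set \<Rightarrow> 'a set \<Rightarrow> 'a set" where
  "compositum R L K = generate_field R (L \<union> K)"

text \<open>
  Polynomials are coefficient lists with the leading coefficient first, so the list below is
  $X^4 + uX^2 + w$; \<open>ring.Irr R F \<alpha>\<close> is the minimal polynomial of \<open>\<alpha>\<close> over \<open>F\<close>.
\<close>

definition biquadratic_generator ::
    "('a, 'b) ring_scheme \<Rightarrow> 'a set \<Rightarrow> 'a set \<Rightarrow> 'a \<Rightarrow> 'a \<Rightarrow> 'a \<Rightarrow> bool" where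
  "biquadratic_generator R F L \<alpha> u w \<longleftrightarrow>
     \<alpha> \<in> L \<and> L = adjoin R F \<alpha> \<and> u \<in> F \<and> w \<in> F \<and>
     ring.Irr R F \<alpha> = [\<one>\<^bsub>R\<^esub>, \<zero>\<^bsub>R\<^esub>, u, \<zero>\<^bsub>R\<^esub>, w]"

definition biquadratic_ext :: "('a, 'b) ring_scheme \<Rightarrow> 'a set \<Rightarrow> 'a set \<Rightarrow> bool" where
  "biquadratic_ext R F L \<longleftrightarrow>
     quartic_ext R F L \<and> (\<exists>\<alpha> u w. biquadratic_generator R F L \<alpha> u w)"

text \<open>
  Automorphisms are represented by functions that are extensional on \<open>L\<close>, so that each of them
  has exactly one representative.
\<close>

definition aut_group :: "('a, 'b) ring_scheme \<Rightarrow> 'a set \<Rightarrow> 'a set \<Rightarrow> ('a \<Rightarrow> 'a) monoid" where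
  "aut_group R F L = BijGroup L \<lparr> carrier :=
     {\<sigma> \<in> Bij L. \<sigma> \<in> ring_hom (R \<lparr> carrier := L \<rparr>) (R \<lparr> carrier := L \<rparr>) \<and> (\<forall>x\<in>F. \<sigma> x = x)} \<rparr>"

definition galois_ext :: "('a, 'b) ring_scheme \<Rightarrow> 'a set \<Rightarrow> 'a set \<Rightarrow> bool" where
  "galois_ext R F L \<longleftrightarrow>
     field_ext R F L \<and> (\<forall>x\<in>L. (ring.algebraic R over F) x) \<and>
     {x \<in> L. \<forall>\<sigma> \<in> carrier (aut_group R F L). \<sigma> x = x} = F"

definition cyclic_quartic_ext :: "('a, 'b) ring_scheme \<Rightarrow> 'a set \<Rightarrow> 'a set \<Rightarrow> bool" where
  "cyclic_quartic_ext R F L \<longleftrightarrow>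
     quartic_ext R F L \<and> galois_ext R F L \<and> aut_group R F L \<cong> integer_mod_group 4"

definition elementary_abelian_quartic_ext ::
    "('a, 'b) ring_scheme \<Rightarrow> 'a set \<Rightarrow> 'a set \<Rightarrow> bool" where
  "elementary_abelian_quartic_ext R F L \<longleftrightarrow>
     quartic_ext R F L \<and> galois_ext R F L \<and>
     aut_group R F L \<cong> integer_mod_group 2 \<times>\<times> integer_mod_group 2"

text \<open>
  The next two notions are meant for quartic \<open>L\<close> over \<open>F\<close>: the degree of \<open>LK\<close> over \<open>K\<close> is
  required to be 4 by \<open>elementary_abelian_quartic_ext\<close>. The competitors \<open>K\<close> range over
  all intermediate fields of the ambient field, including those of infinite degree over \<open>F\<close>.
\<close>

definition elementary_abelian_over ::
    "('a, 'b) ring_scheme \<Rightarrow> 'a set \<Rightarrow> 'a set \<Rightarrow> 'a set \<Rightarrow> bool" where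
  "elementary_abelian_over R F L K \<longleftrightarrow>
     field_ext R F K \<and> elementary_abelian_quartic_ext R K (compositum R L K)"

definition elementary_abelian_closure ::
    "('a, 'b) ring_scheme \<Rightarrow> 'a set \<Rightarrow> 'a set \<Rightarrow> 'a set \<Rightarrow> bool" where
  "elementary_abelian_closure R F L K \<longleftrightarrow>
     elementary_abelian_over R F L K \<and>
     (\<forall>K'. elementary_abelian_over R F L K' \<longrightarrow> ext_degree R F K \<le> ext_degree R F K')"

end

theory Submission
  imports Defs
begin

text \<open>
  The roots of $X^4 + uX^2 + w$ are $\pm\alpha, \pm\beta$ with $\eta = \alpha\beta$ a square root of $w$.
  Over a field $K \supseteq F$ over which the polynomial stays irreducible, $K(\alpha)/K$ has four
  automorphisms iff $\beta \in K(\alpha)$, and then it is Galois. An automorphism with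
  $\alpha \mapsto \pm\beta$ is an involution iff it fixes $\eta$, so $K(\alpha)/K$ is elementary abelian iff
  $\eta \in K$, and cyclic iff $\eta \in K(\alpha) \setminus K$. Hence $F(\eta)$ is contained in every field
  $K$ that makes $LK/K$ elementary abelian quartic; it has this property itself iff the polynomial is
  irreducible over $F(\eta)$, which fails exactly when $\eta \in L \setminus F$, the cyclic case.
  Irreducibility over $K$ is expressed throughout as linear independence of
  $1, \alpha, \alpha^2, \alpha^3$ over $K$, which makes the comparison of $F$ with $F(\eta)$ elementary.
\<close>

section \<open>The two groups of order four\<close>

text \<open>In order four, an element whose square is not the identity has order dividing 4 but not
  2, so it generates the group. The criterion looks only at squares because that is how
  automorphisms are tested later.\<close>

lemma (in group) iso_cyclic4_iff:
  "G \<cong> integer_mod_group 4 \<longleftrightarrow> card (carrier G) = 4 \<and> (\<exists>x\<in>carrier G. x \<otimes> x \<noteq> \<one>)"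
proof
  assume "G \<cong> integer_mod_group 4"
  then obtain h where h: "h \<in> iso G (integer_mod_group 4)" by (auto simp: is_iso_def)
  then have bij: "bij_betw h (carrier G) {0..<4}" and hom: "h \<in> hom G (integer_mod_group 4)"
    by (auto simp: iso_def carrier_integer_mod_group)
  have "card (carrier G) = 4" using bij_betw_same_card[OF bij] by simp
  moreover have "1 \<in> h ` carrier G" using bij_betw_imp_surj_on[OF bij] by simp
  then obtain x where x: "x \<in> carrier G" "h x = 1" by auto
  have "h (x \<otimes> x) = 2" using hom x by (simp add: hom_mult)
  moreover have "h \<one> = 0"
    using hom_one[OF hom is_group group_integer_mod_group] by simp
  ultimately show "card (carrier G) = 4 \<and> (\<exists>x\<in>carrier G. x \<otimes> x \<noteq> \<one>)"
    using x(1) by force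
next
  assume "card (carrier G) = 4 \<and> (\<exists>x\<in>carrier G. x \<otimes> x \<noteq> \<one>)"
  then obtain x where card: "card (carrier G) = 4" and x: "x \<in> carrier G" "x \<otimes> x \<noteq> \<one>" by blast
  have fin: "finite (carrier G)" using card by (simp add: card_ge_0_finite)
  have "ord x dvd 4" using ord_dvd_group_order[OF x(1)] card by (simp add: order_def)
  moreover have "\<not> ord x dvd 2"
    using pow_eq_id[OF x(1), of 2] x by (simp add: numeral_2_eq_2)
  moreover have "ord x \<le> 4" using \<open>ord x dvd 4\<close> by (auto dest: dvd_imp_le)
  then have "ord x = 0 \<or> ord x = 1 \<or> ord x = 2 \<or> ord x = 3 \<or> ord x = 4" by linarith
  ultimately have ord: "ord x = 4" by auto
  let ?h = "\<lambda>k::int. x [^] k"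
  have "?h \<in> hom (integer_mod_group 4) G"
  proof (rule homI)
    fix i j :: int
    \<comment> \<open>The operation of \<open>integer_mod_group 4\<close> reduces the sum modulo 4;
      the exponent does not notice this, since \<open>ord x\<close> is 4.\<close>
    have "x [^] ((i + j) mod 4) = x [^] (i + j)"
      unfolding int_pow_eq[OF x(1)] ord by (simp add: mod_eq_dvd_iff[symmetric] del: mod_add_eq)
    then show "x [^] (i \<otimes>\<^bsub>integer_mod_group 4\<^esub> j) = x [^] i \<otimes> x [^] j"
      using x(1) by (simp add: int_pow_mult)
  qed (use x in simp)
  moreover have inj: "inj_on ?h {0..<4}"
    unfolding inj_on_def int_pow_eq[OF x(1)] ord by (auto simp: mod_eq_dvd_iff[symmetric])
  then have "?h ` {0..<4} = carrier G"
    using x(1) fin card by (intro card_subset_eq) (auto simp: card_image)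
  ultimately have "?h \<in> iso (integer_mod_group 4) G"
    using inj by (auto simp: iso_def bij_betw_def carrier_integer_mod_group)
  then show "G \<cong> integer_mod_group 4"
    using group.iso_sym[OF group_integer_mod_group] by (auto simp: is_iso_def)
qed

text \<open>Exponent two makes the group abelian, and two distinct nontrivial elements
  \<open>a\<close>, \<open>b\<close> then have four different products 1, \<open>a\<close>,
  \<open>b\<close>, \<open>ab\<close>.\<close>

lemma (in group) iso_klein4_iff:
  "G \<cong> integer_mod_group 2 \<times>\<times> integer_mod_group 2 \<longleftrightarrow>
     card (carrier G) = 4 \<and> (\<forall>x\<in>carrier G. x \<otimes> x = \<one>)"
proof
  let ?V = "integer_mod_group 2 \<times>\<times> integer_mod_group 2"
  assume "G \<cong> ?V"
  then obtain h where h: "h \<in> iso G ?V" by (auto simp: is_iso_def)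
  then have bij: "bij_betw h (carrier G) ({0..<2} \<times> {0..<2})" and hom: "h \<in> hom G ?V"
    by (auto simp: iso_def carrier_integer_mod_group DirProd_def)
  have "card (carrier G) = 4" using bij_betw_same_card[OF bij] by simp
  moreover have "x \<otimes> x = \<one>" if x: "x \<in> carrier G" for x
  proof -
    obtain i j where ij: "h x = (i, j)" by force
    have "h (x \<otimes> x) = (0, 0)" using hom x ij by (simp add: hom_mult)
    moreover have "h \<one> = (0, 0)"
      using hom_one[OF hom is_group DirProd_group[OF group_integer_mod_group group_integer_mod_group]]
      by simp
    ultimately show ?thesis using bij x by (auto simp: bij_betw_def inj_on_def)
  qed
  ultimately show "card (carrier G) = 4 \<and> (\<forall>x\<in>carrier G. x \<otimes> x = \<one>)" by blast
next
  let ?V = "integer_mod_group 2 \<times>\<times> integer_mod_group 2"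
  assume "card (carrier G) = 4 \<and> (\<forall>x\<in>carrier G. x \<otimes> x = \<one>)"
  then have card: "card (carrier G) = 4" and sq: "\<And>x. x \<in> carrier G \<Longrightarrow> x \<otimes> x = \<one>" by blast+
  have fin: "finite (carrier G)" using card by (simp add: card_ge_0_finite)
  have outside: "\<exists>a. a \<in> carrier G \<and> a \<notin> A" if "finite A" "card A < 4" for A
    using that card card_mono[of A "carrier G"] by force
  from this[of "{\<one>}"] obtain a where a: "a \<in> carrier G" "a \<noteq> \<one>" by auto
  have "card {\<one>, a} < 4" by (simp add: card_insert_if)
  with outside[of "{\<one>, a}"]
  obtain b where b: "b \<in> carrier G" "b \<noteq> \<one>" "b \<noteq> a" by auto
  have inv: "inv x = x" if "x \<in> carrier G" for x using sq that inv_equality by blast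
  have comm: "x \<otimes> y = y \<otimes> x" if "x \<in> carrier G" "y \<in> carrier G" for x y
    using inv that by (metis inv_mult_group m_closed)
  have ab: "a \<otimes> b \<noteq> \<one>" "a \<otimes> b \<noteq> a" "a \<otimes> b \<noteq> b"
    using a b inv[of a] inv_equality[of b a] comm[of a b] r_cancel_one[of b a] l_cancel_one[of a b] by auto
  \<comment> \<open>A pair of residues is read as the exponents of \<open>a\<close> and
    \<open>b\<close>.\<close>
  define h where "h = (\<lambda>(i::int, j::int). (if i = 0 then \<one> else a) \<otimes> (if j = 0 then \<one> else b))"
  have V: "carrier ?V = {(0,0), (0,1), (1,0), (1,1)}"
    by (auto simp: carrier_integer_mod_group DirProd_def)
  \<comment> \<open>Moving equal factors together and cancelling their squares brings every product
    of \<open>a\<close> and \<open>b\<close> to one of the four values of \<open>h\<close>.\<close>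
  have lcomm: "x \<otimes> (y \<otimes> z) = y \<otimes> (x \<otimes> z)"
    if "x \<in> carrier G" "y \<in> carrier G" "z \<in> carrier G" for x y z
    using that comm m_assoc by metis
  have cancel: "x \<otimes> (x \<otimes> y) = y" if "x \<in> carrier G" "y \<in> carrier G" for x y
    using that sq by (simp flip: m_assoc)
  have "h \<in> hom ?V G"
  proof (rule homI)
    show "h p \<in> carrier G" if "p \<in> carrier ?V" for p
      using that a b by (auto simp: V h_def)
    show "h (p \<otimes>\<^bsub>?V\<^esub> q) = h p \<otimes> h q" if "p \<in> carrier ?V" "q \<in> carrier ?V" for p q
      using that a b unfolding V by (auto simp: h_def sq comm[of b a] lcomm[of b a] cancel m_assoc)
  qed
  moreover have inj: "inj_on h (carrier ?V)"
    using a b ab unfolding V by (auto simp: h_def)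
  moreover have "h ` carrier ?V = carrier G"
  proof (rule card_subset_eq[OF fin])
    show "h ` carrier ?V \<subseteq> carrier G" using a b by (auto simp: V h_def)
    show "card (h ` carrier ?V) = card (carrier G)"
      using card_image[OF inj] card by (simp add: carrier_integer_mod_group)
  qed
  ultimately have "h \<in> iso ?V G" by (auto simp: iso_def bij_betw_def)
  then show "G \<cong> ?V"
    using group.iso_sym[OF DirProd_group[OF group_integer_mod_group group_integer_mod_group]]
    by (auto simp: is_iso_def)
qed

section \<open>Automorphism groups of extensions\<close>

context field
begin

lemma subfield_inv_closed: "subfield L R \<Longrightarrow> x \<in> L \<Longrightarrow> x \<noteq> \<zero> \<Longrightarrow> inv x \<in> L"
  using subfield_m_inv(1)[of L x] by simp

lemma inv_cancel:
  assumes "x \<in> carrier R" "x \<noteq> \<zero>"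
  shows "inv x \<in> carrier R" "x \<otimes> inv x = \<one>" "inv x \<otimes> x = \<one>"
  using subfield_m_inv[OF carrier_is_subfield, of x] assms by auto

lemma carrier_aut_group:
  "f \<in> carrier (aut_group R K L) \<longleftrightarrow>
     f \<in> Bij L \<and> f \<in> ring_hom (R\<lparr>carrier := L\<rparr>) (R\<lparr>carrier := L\<rparr>) \<and> (\<forall>x\<in>K. f x = x)"
  by (simp add: aut_group_def)

lemma aut_groupI:
  assumes "f \<in> extensional L" "bij_betw f L L" "f \<one> = \<one>"
    "\<And>x y. x \<in> L \<Longrightarrow> y \<in> L \<Longrightarrow> f (x \<otimes> y) = f x \<otimes> f y"
    "\<And>x y. x \<in> L \<Longrightarrow> y \<in> L \<Longrightarrow> f (x \<oplus> y) = f x \<oplus> f y"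
    "\<And>x. x \<in> K \<Longrightarrow> f x = x"
  shows "f \<in> carrier (aut_group R K L)"
  using assms bij_betw_imp_funcset[OF assms(2)]
  by (auto simp: carrier_aut_group Bij_def ring_hom_def Pi_iff)

section \<open>Automorphisms over K and the field operations\<close>

context
  fixes K L f
  assumes L: "subfield L R" and f: "f \<in> carrier (aut_group R K L)"
begin

lemma aut_closed: "x \<in> L \<Longrightarrow> f x \<in> L"
  and aut_inj: "inj_on f L"
  and aut_mult: "x \<in> L \<Longrightarrow> y \<in> L \<Longrightarrow> f (x \<otimes> y) = f x \<otimes> f y"
  and aut_add: "x \<in> L \<Longrightarrow> y \<in> L \<Longrightarrow> f (x \<oplus> y) = f x \<oplus> f y"
  and aut_one: "f \<one> = \<one>"
  and aut_fix: "x \<in> K \<Longrightarrow> f x = x"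
  using f by (auto simp: carrier_aut_group ring_hom_def Bij_def bij_betw_def)

lemma aut_minus: "x \<in> L \<Longrightarrow> f (\<ominus> x) = \<ominus> f x"
proof -
  assume x: "x \<in> L"
  have mem: "\<ominus> x \<in> L" "\<zero> \<in> L" "L \<subseteq> carrier R" "f x \<in> L" "f \<zero> \<in> L" "f (\<ominus> x) \<in> L"
    using x subringE[OF subfieldE(1)[OF L]] aut_closed by auto
  \<comment> \<open>Membership in \<open>ring_hom\<close> speaks of sums, products and one; zero is
    recovered as an element equal to its own double.\<close>
  have "f \<zero> \<oplus> f \<zero> = f \<zero>" using aut_add[of \<zero> \<zero>] mem by simp
  then have zero: "f \<zero> = \<zero>" using mem(3,5) add.l_cancel_one by blast
  have "x \<oplus> \<ominus> x = \<zero>" using x mem by (intro r_neg) auto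
  then have "f x \<oplus> f (\<ominus> x) = \<zero>" using aut_add[of x "\<ominus> x"] x mem zero by simp
  then show ?thesis using mem by (metis minus_equality a_comm subsetD)
qed

lemma aut_inv: "x \<in> L \<Longrightarrow> x \<noteq> \<zero> \<Longrightarrow> f (inv x) = inv (f x)"
proof -
  assume x: "x \<in> L" "x \<noteq> \<zero>"
  have mem: "inv x \<in> L" "L \<subseteq> carrier R" "f x \<in> L" "f (inv x) \<in> L"
    using x subfield_inv_closed[OF L] subfieldE(3)[OF L] aut_closed by auto
  have "x \<otimes> inv x = \<one>" using x mem(2) inv_cancel by blast
  then have "f x \<otimes> f (inv x) = \<one>" using aut_mult[of x "inv x"] x mem aut_one by simp
  then show ?thesis using mem by (metis comm_inv_char subsetD)
qed

end

section \<open>The automorphism group and its action on a generator\<close>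

lemma aut_group_mult:
  assumes "f \<in> carrier (aut_group R K L)" "g \<in> carrier (aut_group R K L)" "x \<in> L"
  shows "(f \<otimes>\<^bsub>aut_group R K L\<^esub> g) x = f (g x)"
  using assms by (simp add: carrier_aut_group) (simp add: aut_group_def BijGroup_def compose_def)

lemma aut_group_one: "x \<in> L \<Longrightarrow> \<one>\<^bsub>aut_group R K L\<^esub> x = x"
  by (simp add: aut_group_def BijGroup_def)

lemma group_aut_group:
  assumes L: "subfield L R" and KL: "K \<subseteq> L"
  shows "group (aut_group R K L)"
proof -
  interpret B: group "BijGroup L" by (rule group_BijGroup)
  note sub = subringE[OF subfieldE(1)[OF L]]
  have "subgroup (carrier (aut_group R K L)) (BijGroup L)"
  proof (rule B.subgroupI)
    show "carrier (aut_group R K L) \<subseteq> carrier (BijGroup L)"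
      by (auto simp: carrier_aut_group BijGroup_def)
    have "(\<lambda>x\<in>L. x) \<in> carrier (aut_group R K L)"
      using sub KL by (intro aut_groupI) (auto simp: bij_betw_def inj_on_def)
    then show "carrier (aut_group R K L) \<noteq> {}" by blast
  next
    fix f assume f: "f \<in> carrier (aut_group R K L)"
    then have bij: "f \<in> Bij L" by (simp add: carrier_aut_group)
    then have bb: "bij_betw f L L" by (simp add: Bij_def)
    \<comment> \<open>The restriction keeps the inverse extensional on \<open>L\<close>, as the
      representatives of automorphisms have to be.\<close>
    let ?g = "\<lambda>x\<in>L. inv_into L f x"
    have left: "inv_into L f (f x) = x" if "x \<in> L" for x
      using bb that by (simp add: bij_betw_def)
    have onto: "\<exists>y\<in>L. x = f y" if "x \<in> L" for x
      using bb that by (auto simp: bij_betw_def)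
    have "?g \<in> carrier (aut_group R K L)"
    proof (rule aut_groupI)
      show "bij_betw ?g L L" using restrict_inv_into_Bij[OF bij] by (simp add: Bij_def)
      show "?g \<one> = \<one>" using left[of \<one>] sub aut_one[OF L f] by simp
      show "?g x = x" if "x \<in> K" for x
        using left[of x] that KL aut_fix[OF L f] by auto
      show "?g (x \<otimes> y) = ?g x \<otimes> ?g y" "?g (x \<oplus> y) = ?g x \<oplus> ?g y" if xL: "x \<in> L" and yL: "y \<in> L" for x y
      proof -
        obtain x' y' where xy: "x' \<in> L" "x = f x'" "y' \<in> L" "y = f y'" using onto[OF xL] onto[OF yL] by blast
        \<comment> \<open>With both arguments written as images under \<open>f\<close>, the
          homomorphism laws of \<open>f\<close> become those of its inverse.\<close>
        have "?g (f (x' \<otimes> y')) = x' \<otimes> y'" "?g (f (x' \<oplus> y')) = x' \<oplus> y'"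
          "?g (f x') = x'" "?g (f y') = y'"
          using left sub xy aut_closed[OF L f] by auto
        then show "?g (x \<otimes> y) = ?g x \<otimes> ?g y" "?g (x \<oplus> y) = ?g x \<oplus> ?g y"
          using xy aut_mult[OF L f] aut_add[OF L f] by metis+
      qed
    qed simp
    then show "inv\<^bsub>BijGroup L\<^esub> f \<in> carrier (aut_group R K L)"
      using inv_BijGroup[OF bij] by simp
  next
    fix f g assume f: "f \<in> carrier (aut_group R K L)" and g: "g \<in> carrier (aut_group R K L)"
    then have bij: "f \<in> Bij L" "g \<in> Bij L" by (simp_all add: carrier_aut_group)
    have "compose L f g \<in> carrier (aut_group R K L)"
      using compose_Bij[OF bij] sub KL aut_closed[OF L g] aut_one[OF L f] aut_one[OF L g]
        aut_mult[OF L f] aut_mult[OF L g] aut_add[OF L f] aut_add[OF L g]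
        aut_fix[OF L f] aut_fix[OF L g]
      by (intro aut_groupI) (auto simp: Bij_def compose_def)
    then show "f \<otimes>\<^bsub>BijGroup L\<^esub> g \<in> carrier (aut_group R K L)"
      using bij by (simp add: BijGroup_def)
  qed
  from B.subgroup_imp_group[OF this] show ?thesis by (simp add: aut_group_def)
qed

text \<open>The elements on which two automorphisms agree are closed under the field operations, as
  the induction over the generated field shows. Automorphisms can therefore be counted by their
  values at a generator.\<close>

lemma aut_eqI:
  assumes L: "subfield L R" "L = adjoin R K x"
    and f: "f \<in> carrier (aut_group R K L)" and g: "g \<in> carrier (aut_group R K L)"
    and eq: "f x = g x"
  shows "f = g"
proof (rule extensionalityI)
  show "f \<in> extensional L" "g \<in> extensional L"
    using f g by (auto simp: carrier_aut_group Bij_def)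
  fix y assume "y \<in> L"
  then have "y \<in> generate_field R (insert x K)" using L(2) by (simp add: adjoin_def)
  then show "f y = g y"
  proof induction
    case one
    then show ?case using aut_one[OF L(1)] f g by metis
  next
    case (incl h)
    then show ?case using eq aut_fix[OF L(1) f] aut_fix[OF L(1) g] by auto
  next
    case (a_inv h)
    then show ?case using aut_minus[OF L(1) f] aut_minus[OF L(1) g] L(2) by (simp add: adjoin_def)
  next
    case (m_inv h)
    then show ?case using aut_inv[OF L(1) f] aut_inv[OF L(1) g] L(2) by (simp add: adjoin_def)
  next
    case (eng_add h1 h2)
    then show ?case using aut_add[OF L(1) f] aut_add[OF L(1) g] L(2) by (simp add: adjoin_def)
  next
    case (eng_mult h1 h2)
    then show ?case using aut_mult[OF L(1) f] aut_mult[OF L(1) g] L(2) by (simp add: adjoin_def)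
  qed
qed

end

section \<open>Simple extensions of degree four\<close>

text \<open>Coefficients run from the constant term upwards, opposite to the coefficient lists of
  the polynomial ring.\<close>

definition (in ring) cubic :: "'a \<Rightarrow> 'a \<Rightarrow> 'a \<Rightarrow> 'a \<Rightarrow> 'a \<Rightarrow> 'a" where
  "cubic a b c d x = a \<oplus> b \<otimes> x \<oplus> c \<otimes> (x \<otimes> x) \<oplus> d \<otimes> (x \<otimes> x \<otimes> x)"

text \<open>Independence of the first four powers of \<open>x\<close>, spelled out with coefficients
  in \<open>K\<close> so that it visibly passes to every subset of \<open>K\<close>.\<close>

definition (in ring) cubic_free :: "'a set \<Rightarrow> 'a \<Rightarrow> bool" where
  "cubic_free K x \<longleftrightarrow> (\<forall>a\<in>K. \<forall>b\<in>K. \<forall>c\<in>K. \<forall>d\<in>K.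
     cubic a b c d x = \<zero> \<longrightarrow> a = \<zero> \<and> b = \<zero> \<and> c = \<zero> \<and> d = \<zero>)"

context field
begin

lemma cubic_freeD:
  assumes "cubic_free K x" "a \<in> K" "b \<in> K" "c \<in> K" "d \<in> K" "cubic a b c d x = \<zero>"
  shows "a = \<zero>" "b = \<zero>" "c = \<zero>" "d = \<zero>"
  using assms unfolding cubic_free_def by blast+

section \<open>Adjoining one element, and composita\<close>

lemma adjoin_subfield:
  assumes "subfield K R" "x \<in> carrier R"
  shows "subfield (adjoin R K x) R" "K \<subseteq> adjoin R K x" "x \<in> adjoin R K x"
  using assms subfieldE(3)[OF assms(1)] generate_field_is_subfield[of "insert x K"]
  by (auto simp: adjoin_def intro: generate_field.incl)

lemma adjoin_minimal:
  assumes "subfield E R" "K \<subseteq> E" "x \<in> E"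
  shows "adjoin R K x \<subseteq> E"
proof -
  have "insert x K \<subseteq> carrier R" using assms subfieldE(3)[OF assms(1)] by blast
  then show ?thesis
    using generate_field_min_subfield1[OF _ assms(1)] assms(2,3) by (simp add: adjoin_def)
qed

text \<open>Since \<open>F\<close> lies in \<open>K\<close>, both sides are the smallest subfield
  containing \<open>K\<close> and \<open>x\<close>.\<close>

lemma compositum_adjoin:
  assumes "subfield F R" "subfield K R" "F \<subseteq> K" "x \<in> carrier R"
  shows "compositum R (adjoin R F x) K = adjoin R K x"
proof
  note F = adjoin_subfield[OF assms(1,4)] and K = adjoin_subfield[OF assms(2,4)]
  have carr: "adjoin R F x \<union> K \<subseteq> carrier R"
    using subfieldE(3)[OF F(1)] subfieldE(3)[OF assms(2)] by simp
  have "adjoin R F x \<union> K \<subseteq> adjoin R K x"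
    using adjoin_minimal[OF K(1)] K assms(3) by auto
  then show "compositum R (adjoin R F x) K \<subseteq> adjoin R K x"
    using generate_field_min_subfield1[OF carr K(1)] by (simp add: compositum_def)
  have "adjoin R F x \<union> K \<subseteq> compositum R (adjoin R F x) K"
    unfolding compositum_def by (auto intro: generate_field.incl)
  then show "adjoin R K x \<subseteq> compositum R (adjoin R F x) K"
    using adjoin_minimal[of "compositum R (adjoin R F x) K" K x] generate_field_is_subfield[OF carr] F(3)
    by (auto simp: compositum_def)
qed

text \<open>For algebraic \<open>x\<close> the polynomial expressions in \<open>x\<close> already
  form a field. This carries facts on dimension and evaluation over to
  \<open>adjoin\<close>.\<close>

lemma adjoin_eq_simple_extension:
  assumes "subfield K R" "x \<in> carrier R" "(algebraic over K) x"
  shows "adjoin R K x = simple_extension K x"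
proof
  have sub: "subfield (simple_extension K x) R"
    using simple_extension_is_subfield assms by blast
  then show "adjoin R K x \<subseteq> simple_extension K x"
    using adjoin_minimal simple_extension_incl[OF subfieldE(3)[OF assms(1)] assms(2)]
      simple_extension_mem[OF subfieldE(1)[OF assms(1)] assms(2)] by blast
  show "simple_extension K x \<subseteq> adjoin R K x"
    using simple_extension_subring_incl[OF subfieldE(1)] adjoin_subfield[OF assms(1,2)] by blast
qed

text \<open>One long division serves all roots of \<open>q\<close> at once, which later allows
  values at \<alpha> and at another root to be compared. Length is bounded instead of degree because
  the zero polynomial and nonzero constants share degree 0.\<close>

lemma eval_mod:
  assumes K: "subfield K R" and p: "p \<in> carrier (K[X])" and q: "q \<in> carrier (K[X])" "q \<noteq> []"
  obtains r where "r \<in> carrier (K[X])" "length r < length q"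
    "\<And>x. x \<in> carrier R \<Longrightarrow> eval q x = \<zero> \<Longrightarrow> eval p x = eval r x"
proof -
  obtain b r where br: "b \<in> carrier (K[X])" "r \<in> carrier (K[X])"
    and dvd: "p = q \<otimes>\<^bsub>K[X]\<^esub> b \<oplus>\<^bsub>K[X]\<^esub> r" "r = [] \<or> degree r < degree q"
    using subfield_long_division_theorem_shell[OF K p q(1)] q(2) unfolding univ_poly_zero by auto
  have "eval p x = eval r x" if x: "x \<in> carrier R" and root: "eval q x = \<zero>" for x
  proof -
    interpret ev: ring_hom_ring "K[X]" R "\<lambda>p. eval p x"
      by (rule eval_ring_hom[OF subfieldE(1)[OF K] x])
    show ?thesis using br q(1) root by (simp add: dvd(1))
  qed
  moreover have "length r < length q" using dvd(2) q(2) by auto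
  ultimately show thesis using that br(2) by blast
qed

lemma adjoin_eval:
  assumes K: "subfield K R" and x: "x \<in> carrier R" and q: "q \<in> carrier (K[X])" "q \<noteq> []"
    and root: "eval q x = \<zero>" and y: "y \<in> adjoin R K x"
  obtains r where "r \<in> carrier (K[X])" "length r < length q" "y = eval r x"
proof -
  have "(algebraic over K) x" using algebraicI[OF q root] .
  then obtain p where p: "p \<in> carrier (K[X])" "y = eval p x"
    using y adjoin_eq_simple_extension[OF K x] simple_extension_as_eval_img[OF subfieldE(3)[OF K] x]
    by auto
  from eval_mod[OF K p(1) q] show thesis using that p(2) x root by metis
qed

section \<open>Coordinates with respect to 1, x, x^2, x^3\<close>

lemma eval_list4:
  assumes "a \<in> carrier R" "b \<in> carrier R" "c \<in> carrier R" "d \<in> carrier R" "x \<in> carrier R"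
  shows "eval [d, c, b, a] x = cubic a b c d x"
proof -
  have "eval [d, c, b, a] x = d \<otimes> (x \<otimes> x \<otimes> x) \<oplus> (c \<otimes> (x \<otimes> x) \<oplus> (b \<otimes> x \<oplus> a))"
    using assms by (simp add: numeral_3_eq_3 numeral_2_eq_2)
  also have "\<dots> = cubic a b c d x" unfolding cubic_def using assms by algebra
  finally show ?thesis .
qed

text \<open>Leading zeros pad \<open>p\<close> to exactly four coefficients. The inclusion of
  \<open>set p\<close> lets vanishing coordinates be read back as vanishing coefficients of
  \<open>p\<close>.\<close>

lemma eval_eq_cubic:
  assumes "subfield K R" "set p \<subseteq> K" "length p \<le> 4"
  obtains a b c d where "a \<in> K" "b \<in> K" "c \<in> K" "d \<in> K" "set p \<subseteq> {a, b, c, d}"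
    "\<And>x. x \<in> carrier R \<Longrightarrow> eval p x = cubic a b c d x"
proof -
  note K = subringE[OF subfieldE(1)[OF assms(1)]]
  define q where "q = replicate (4 - length p) \<zero> @ p"
  have "length q = Suc (Suc (Suc (Suc 0)))" using assms(3) by (simp add: q_def)
  then obtain d c b a where abcd: "q = [d, c, b, a]"
    by (auto simp: length_Suc_conv)
  have "set q \<subseteq> K" using assms(2) K(2) by (auto simp: q_def)
  then have mem: "a \<in> K" "b \<in> K" "c \<in> K" "d \<in> K" by (auto simp: abcd)
  have "eval p x = cubic a b c d x" if x: "x \<in> carrier R" for x
  proof -
    have "eval p x = eval q x"
      unfolding q_def using eval_replicate[OF _ x] assms(2) K(1) by auto
    also have "\<dots> = cubic a b c d x"
      unfolding abcd using mem K(1) x by (intro eval_list4) auto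
    finally show ?thesis .
  qed
  moreover have "set p \<subseteq> {a, b, c, d}" using arg_cong[OF abcd, of set] by (auto simp: q_def)
  ultimately show thesis using that mem by blast
qed

text \<open>The quartic \<open>q\<close> bounds the degree of the minimal polynomial by four. If
  that degree is smaller, the minimal polynomial is itself a nontrivial cubic relation; if it is
  four, a nontrivial cubic relation would contradict minimality.\<close>

lemma cubic_free_iff_degree:
  assumes K: "subfield K R" and x: "x \<in> carrier R" and q: "q \<in> carrier (K[X])" "length q = 5"
    and root: "eval q x = \<zero>"
  shows "cubic_free K x \<longleftrightarrow> ext_degree R K (adjoin R K x) = 4"
proof -
  have qn: "q \<noteq> []" using q(2) by auto
  have alg: "(algebraic over K) x" using algebraicI[OF q(1) qn root] .
  note Irr = IrrE[OF K x alg]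
  have ne: "Irr K x \<noteq> []" using Irr(2) by (auto simp: ring_irreducible_def univ_poly_zero)
  have min: "degree (Irr K x) \<le> degree p"
    if "p \<in> carrier (K[X])" "p \<noteq> []" "eval p x = \<zero>" for p
    using pdivides_imp_degree_le[OF subfieldE(1)[OF K] Irr(1) that(1,2)] Irr_minimal[OF K x alg that(1,3)]
    by blast
  have le: "degree (Irr K x) \<le> 4" using min[OF q(1) qn root] q(2) by simp
  have deg: "ext_degree R K (adjoin R K x) = enat (degree (Irr K x))"
    using finite_dimension_simple_extension[OF K x] simple_extension_dim[OF K x alg] alg
      adjoin_eq_simple_extension[OF K x alg]
    by (simp add: ext_degree_def over_def)
  have "cubic_free K x \<longleftrightarrow> degree (Irr K x) = 4"
  proof
    assume free: "cubic_free K x"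
    show "degree (Irr K x) = 4"
    proof (rule ccontr)
      assume "degree (Irr K x) \<noteq> 4"
      with le have len: "length (Irr K x) \<le> 4" by linarith
      have set: "set (Irr K x) \<subseteq> K"
        using Irr(1) polynomial_incl by (simp add: univ_poly_carrier)
      obtain a b c d where abcd: "a \<in> K" "b \<in> K" "c \<in> K" "d \<in> K" "set (Irr K x) \<subseteq> {a, b, c, d}"
        "eval (Irr K x) x = cubic a b c d x"
        using eval_eq_cubic[OF K set len] x by metis
      then have "a = \<zero> \<and> b = \<zero> \<and> c = \<zero> \<and> d = \<zero>"
        using cubic_freeD[OF free abcd(1-4)] Irr(4) by metis
      then have "set (Irr K x) \<subseteq> {\<zero>}" using abcd(5) by auto
      \<comment> \<open>The minimal polynomial is monic, so its coefficients cannot all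
        vanish.\<close>
      moreover have "\<one> \<in> set (Irr K x)" using Irr(3) ne hd_in_set by metis
      ultimately show False by auto
    qed
  next
    assume deg: "degree (Irr K x) = 4"
    show "cubic_free K x" unfolding cubic_free_def
    proof (intro ballI impI)
      fix a b c d assume mem: "a \<in> K" "b \<in> K" "c \<in> K" "d \<in> K" and zero: "cubic a b c d x = \<zero>"
      \<comment> \<open>Members of \<open>K[X]\<close> have no leading zeros, so these are stripped
        first; a list that normalizes to \<open>[]\<close> has only zero entries.\<close>
      let ?p = "normalize [d, c, b, a]"
      have carr: "{a, b, c, d} \<subseteq> carrier R" using mem subfieldE(3)[OF K] by auto
      have "polynomial K ?p" by (rule normalize_gives_polynomial) (use mem in auto)
      then have "?p \<in> carrier (K[X])" by (simp only: univ_poly_carrier)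
      moreover have "eval ?p x = \<zero>"
      proof -
        have "eval ?p x = eval [d, c, b, a] x" using carr by (intro eval_normalize x) auto
        also have "\<dots> = cubic a b c d x" using x carr by (intro eval_list4) auto
        finally show ?thesis using zero by simp
      qed
      moreover have "degree ?p < 4" using normalize_length_le[of "[d, c, b, a]"] by (simp del: normalize.simps)
      ultimately have "?p = []" using min[of ?p] deg by fastforce
      then show "a = \<zero> \<and> b = \<zero> \<and> c = \<zero> \<and> d = \<zero>" by (auto split: if_splits)
    qed
  qed
  then show ?thesis by (simp add: deg numeral_eq_enat)
qed

text \<open>An \<open>F\<close>-basis of \<open>E\<close> stays independent in \<open>K\<close>, and
  if its length is the dimension of \<open>K\<close> it spans \<open>K\<close>. The second claim is
  what turns minimal degree into uniqueness of the closure.\<close>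

lemma ext_degree_mono:
  assumes F: "subfield F R" and E: "subfield E R" and K: "subfield K R" and "F \<subseteq> E" "E \<subseteq> K"
  shows "ext_degree R F E \<le> ext_degree R F K"
    and "finite_dimension F E \<Longrightarrow> ext_degree R F K \<le> ext_degree R F E \<Longrightarrow> K = E"
proof -
  have both: "finite_dimension F E \<and> dim F E \<le> dim F K \<and> (dim F E = dim F K \<longrightarrow> K = E)"
    if fin: "finite_dimension F K"
  proof -
    note sE = subringE[OF subfieldE(1)[OF E]]
    have "subalgebra F E R"
      using subring.axioms(1)[OF subfieldE(1)[OF E]] sE(6) assms(4)
      by (auto simp: subalgebra_def subalgebra_axioms_def)
    then have fE: "finite_dimension F E"
      using subalbegra_incl_imp_finite_dimension[OF F fin] assms(5) by blast
    have dK: "dimension (dim F K) F K" and dE: "dimension (dim F E) F E"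
      using finite_dimensionE[OF F] fin fE by (simp_all add: over_def)
    obtain Us where Us: "set Us \<subseteq> carrier R" "independent F Us" "length Us = dim F E" "Span F Us = E"
      using exists_base[OF F dE] by auto
    have "set Us \<subseteq> K" using Span_base_incl[OF F Us(1)] Us(4) assms(5) by auto
    then show ?thesis
      using independent_length_le_dimension[OF F dK Us(2)] independent_length_eq_dimension[OF F dK Us(2)]
        Us fE by auto
  qed
  show "ext_degree R F E \<le> ext_degree R F K"
    using both by (auto simp: ext_degree_def)
  \<comment> \<open>The degree of \<open>K\<close> is bounded by the finite degree of
    \<open>E\<close>, so \<open>K\<close> has finite degree too and \<open>both\<close>
    applies.\<close>
  show "K = E" if "finite_dimension F E" "ext_degree R F K \<le> ext_degree R F E"
    using both that by (auto simp: ext_degree_def split: if_splits)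
qed

end

section \<open>Biquadratic polynomials\<close>

text \<open>The relations \<open>root_sum\<close> and \<open>root_prod\<close> are Vieta's formulas
  for the factorization of X^4 + uX^2 + w into X^2 - \<alpha>^2 and X^2 - \<beta>^2;
  \<open>free\<close> expresses irreducibility over \<open>F\<close>.\<close>

locale biquadratic = field R for R (structure) +
  fixes F \<alpha> \<beta> u w
  assumes F: "subfield F R" and char: "\<one> \<oplus> \<one> \<noteq> \<zero>"
    and mem: "\<alpha> \<in> carrier R" "\<beta> \<in> carrier R" "u \<in> F" "w \<in> F"
    and root_sum: "\<alpha> \<otimes> \<alpha> \<oplus> \<beta> \<otimes> \<beta> = \<ominus> u"
    and root_prod: "\<alpha> \<otimes> \<beta> \<otimes> (\<alpha> \<otimes> \<beta>) = w"
    and free: "cubic_free F \<alpha>"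
begin

section \<open>The four roots and the square roots of w\<close>

lemma coeffs_carrier: "u \<in> carrier R" "w \<in> carrier R"
  using mem subfieldE(3)[OF F] by auto

lemma root_iff:
  assumes x: "x \<in> carrier R"
  shows "x \<otimes> x \<otimes> (x \<otimes> x) \<oplus> u \<otimes> (x \<otimes> x) \<oplus> w = \<zero> \<longleftrightarrow> x \<in> {\<alpha>, \<ominus> \<alpha>, \<beta>, \<ominus> \<beta>}"
proof -
  have u: "u = \<ominus> (\<alpha> \<otimes> \<alpha> \<oplus> \<beta> \<otimes> \<beta>)" using root_sum coeffs_carrier by (simp add: minus_minus)
  have "x \<otimes> x \<otimes> (x \<otimes> x) \<oplus> u \<otimes> (x \<otimes> x) \<oplus> w =
    (x \<ominus> \<alpha>) \<otimes> (x \<oplus> \<alpha>) \<otimes> ((x \<ominus> \<beta>) \<otimes> (x \<oplus> \<beta>))"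
    unfolding u root_prod[symmetric] using x mem(1,2) by algebra
  moreover have "x \<ominus> y = \<zero> \<longleftrightarrow> x = y" "x \<oplus> y = \<zero> \<longleftrightarrow> x = \<ominus> y" if "y \<in> carrier R" for y
    using that x by (metis r_right_minus_eq) (metis that x minus_equality l_neg)
  ultimately show ?thesis using x mem(1,2) by (auto simp: integral_iff)
qed

lemma double_eq_zero: "x \<in> carrier R \<Longrightarrow> x \<oplus> x = \<zero> \<Longrightarrow> x = \<zero>"
proof -
  assume x: "x \<in> carrier R" "x \<oplus> x = \<zero>"
  have "(\<one> \<oplus> \<one>) \<otimes> x = x \<oplus> x" using x by algebra
  then show ?thesis using x char by (simp add: integral_iff)
qed

text \<open>A coincidence would give one of the relations \<alpha> = 0, u + 2\<alpha>^2 = 0 or u +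
  \<alpha>^2 = 0 over \<open>F\<close>, all excluded by \<open>free\<close>. The characteristic
  separates a nonzero root from its negative.\<close>

lemma roots_distinct:
  "\<alpha> \<noteq> \<zero>" "\<beta> \<noteq> \<zero>" "\<alpha> \<otimes> \<alpha> \<noteq> \<beta> \<otimes> \<beta>" "distinct [\<alpha>, \<ominus> \<alpha>, \<beta>, \<ominus> \<beta>]"
proof -
  note F' = subringE[OF subfieldE(1)[OF F]]
  show alpha: "\<alpha> \<noteq> \<zero>"
    using cubic_freeD(2)[OF free, of \<zero> \<one> \<zero> \<zero>] F' mem(1) by (auto simp: cubic_def)
  show sq: "\<alpha> \<otimes> \<alpha> \<noteq> \<beta> \<otimes> \<beta>"
  proof
    assume eq: "\<alpha> \<otimes> \<alpha> = \<beta> \<otimes> \<beta>"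
    have "cubic u \<zero> (\<one> \<oplus> \<one>) \<zero> \<alpha> = u \<oplus> (\<alpha> \<otimes> \<alpha> \<oplus> \<alpha> \<otimes> \<alpha>)"
      unfolding cubic_def using mem(1) coeffs_carrier by algebra
    also have "\<dots> = \<zero>" using root_sum eq coeffs_carrier by (simp add: r_neg)
    finally show False
      using cubic_freeD(3)[OF free, of u \<zero> "\<one> \<oplus> \<one>" \<zero>] F' mem(3) char by auto
  qed
  show beta: "\<beta> \<noteq> \<zero>"
  proof
    assume "\<beta> = \<zero>"
    then have "\<alpha> \<otimes> \<alpha> = \<ominus> u" using root_sum mem(1) by simp
    then have "cubic u \<zero> \<one> \<zero> \<alpha> = \<zero>"
      using mem(1) coeffs_carrier by (simp add: cubic_def r_neg)
    then show False using cubic_freeD(3)[OF free, of u \<zero> \<one> \<zero>] F' mem(3) by auto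
  qed
  have neg: "x \<noteq> \<ominus> x" if "x \<in> carrier R" "x \<noteq> \<zero>" for x
    using double_eq_zero[OF that(1)] that by (metis r_neg)
  have minus_sq: "\<ominus> x \<otimes> \<ominus> x = x \<otimes> x" if "x \<in> carrier R" for x using that by algebra
  have "\<alpha> \<noteq> \<beta>" "\<alpha> \<noteq> \<ominus> \<beta>" "\<ominus> \<alpha> \<noteq> \<beta>" "\<ominus> \<alpha> \<noteq> \<ominus> \<beta>"
    using sq minus_sq[OF mem(1)] minus_sq[OF mem(2)] by metis+
  then show "distinct [\<alpha>, \<ominus> \<alpha>, \<beta>, \<ominus> \<beta>]"
    using neg alpha beta mem(1,2) by auto
qed

lemma alpha_beta_in_iff:
  assumes "subfield K R" "\<alpha> \<in> K"
  shows "\<alpha> \<otimes> \<beta> \<in> K \<longleftrightarrow> \<beta> \<in> K"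
  using assms(2) subfield_m_inv_simprule[OF assms(1), of \<alpha> \<beta>] roots_distinct(1) mem(2)
    subringE(6)[OF subfieldE(1)[OF assms(1)]] by blast

text \<open>The square roots of \<open>w\<close> are \<alpha>\<beta> and its negative, and a field
  contains both or neither.\<close>

lemma square_in_iff:
  assumes "subfield K R"
  shows "(\<exists>a\<in>K. w = a [^] (2::nat)) \<longleftrightarrow> \<alpha> \<otimes> \<beta> \<in> K"
proof
  note K = subringE[OF subfieldE(1)[OF assms]]
  have eta: "\<alpha> \<otimes> \<beta> \<in> carrier R" using mem by simp
  assume "\<exists>a\<in>K. w = a [^] (2::nat)"
  then obtain a where a: "a \<in> K" "w = a \<otimes> a" using K(1) by (auto simp: numeral_2_eq_2)
  have ac: "a \<in> carrier R" using a K by auto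
  have "(\<alpha> \<otimes> \<beta> \<ominus> a) \<otimes> (\<alpha> \<otimes> \<beta> \<oplus> a) = \<alpha> \<otimes> \<beta> \<otimes> (\<alpha> \<otimes> \<beta>) \<ominus> a \<otimes> a"
    using mem(1,2) ac by algebra
  also have "\<dots> = \<zero>" using root_prod a(2) coeffs_carrier by (simp add: minus_eq r_neg)
  finally have "\<alpha> \<otimes> \<beta> \<ominus> a = \<zero> \<or> \<alpha> \<otimes> \<beta> \<oplus> a = \<zero>" using eta ac by (simp add: integral_iff)
  then have "\<alpha> \<otimes> \<beta> = a \<or> \<alpha> \<otimes> \<beta> = \<ominus> a"
    using eta ac by (metis r_right_minus_eq minus_equality)
  then show "\<alpha> \<otimes> \<beta> \<in> K" using a K(5) by auto
next
  assume "\<alpha> \<otimes> \<beta> \<in> K"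
  then show "\<exists>a\<in>K. w = a [^] (2::nat)"
    using root_prod mem by (intro bexI[of _ "\<alpha> \<otimes> \<beta>"]) (auto simp: numeral_2_eq_2)
qed

section \<open>The quartic over an intermediate field K\<close>

context
  fixes K assumes K: "subfield K R" and FK: "F \<subseteq> K"
begin

lemma minpoly_in: "[\<one>, \<zero>, u, \<zero>, w] \<in> carrier (K[X])"
proof -
  have "set [\<one>, \<zero>, u, \<zero>, w] \<subseteq> K"
    using subringE(2,3)[OF subfieldE(1)[OF K]] FK mem(3,4) by auto
  then have "polynomial K [\<one>, \<zero>, u, \<zero>, w]" by (simp add: polynomial_def)
  then show ?thesis by (simp only: univ_poly_carrier)
qed

lemma eval_minpoly:
  assumes "x \<in> carrier R"
  shows "eval [\<one>, \<zero>, u, \<zero>, w] x = \<zero> \<longleftrightarrow> x \<in> {\<alpha>, \<ominus> \<alpha>, \<beta>, \<ominus> \<beta>}"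
proof -
  have "eval [\<one>, \<zero>, u, \<zero>, w] x = x \<otimes> x \<otimes> (x \<otimes> x) \<oplus> u \<otimes> (x \<otimes> x) \<oplus> w"
    using assms coeffs_carrier by (simp add: numeral_eq_Suc m_assoc a_assoc)
  then show ?thesis using root_iff[OF assms] by simp
qed

lemma cubic_free_iff_ext_degree: "cubic_free K \<alpha> \<longleftrightarrow> ext_degree R K (adjoin R K \<alpha>) = 4"
  using cubic_free_iff_degree[OF K mem(1) minpoly_in] eval_minpoly[OF mem(1)] by simp

lemma adjoin_cubic:
  assumes "y \<in> adjoin R K \<alpha>"
  obtains a b c d where "a \<in> K" "b \<in> K" "c \<in> K" "d \<in> K" "y = cubic a b c d \<alpha>"
proof -
  obtain r where r: "r \<in> carrier (K[X])" "length r < length [\<one>, \<zero>, u, \<zero>, w]" "y = eval r \<alpha>"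
    using adjoin_eval[OF K mem(1) minpoly_in _ _ assms] eval_minpoly[OF mem(1)] by blast
  then have "set r \<subseteq> K" "length r \<le> 4"
    using polynomial_incl by (auto simp: univ_poly_carrier)
  from eval_eq_cubic[OF K this] show thesis using that r(3) mem(1) by metis
qed

lemma adjoin_algebraic: "y \<in> adjoin R K \<alpha> \<Longrightarrow> (algebraic over K) y"
proof -
  have "(algebraic over K) \<alpha>" using algebraicI[OF minpoly_in] eval_minpoly[OF mem(1)] by simp
  then show "y \<in> adjoin R K \<alpha> \<Longrightarrow> (algebraic over K) y"
    using simple_extesion_mem_imp_algebraic[OF K mem(1)] adjoin_eq_simple_extension[OF K mem(1)] by simp
qed

lemma aut_root:
  assumes "f \<in> carrier (aut_group R K (adjoin R K \<alpha>))" and x: "x \<in> adjoin R K \<alpha>" "x \<in> {\<alpha>, \<ominus> \<alpha>, \<beta>, \<ominus> \<beta>}"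
  shows "f x \<in> {\<alpha>, \<ominus> \<alpha>, \<beta>, \<ominus> \<beta>}"
proof -
  let ?L = "adjoin R K \<alpha>"
  have L: "subfield ?L R" and KL: "K \<subseteq> ?L" using adjoin_subfield[OF K mem(1)] by auto
  note L' = subringE[OF subfieldE(1)[OF L]]
  note f = aut_closed[OF L assms(1)] aut_mult[OF L assms(1)] aut_add[OF L assms(1)] aut_fix[OF L assms(1)]
  have uw: "u \<in> ?L" "w \<in> ?L" "u \<in> K" "w \<in> K" using mem FK KL by auto
  have zero: "\<zero> \<in> K" using subringE[OF subfieldE(1)[OF K]] by simp
  have "x \<otimes> x \<otimes> (x \<otimes> x) \<oplus> u \<otimes> (x \<otimes> x) \<oplus> w = \<zero>" using root_iff x L'(1) by blast
  moreover have "f (x \<otimes> x \<otimes> (x \<otimes> x) \<oplus> u \<otimes> (x \<otimes> x) \<oplus> w) =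
      f x \<otimes> f x \<otimes> (f x \<otimes> f x) \<oplus> u \<otimes> (f x \<otimes> f x) \<oplus> w"
    using x(1) uw L'(6,7) by (simp add: f(2-4))
  ultimately have "f x \<otimes> f x \<otimes> (f x \<otimes> f x) \<oplus> u \<otimes> (f x \<otimes> f x) \<oplus> w = \<zero>"
    using f(4)[OF zero] by simp
  moreover have "f x \<in> carrier R" using f(1)[OF x(1)] L'(1) by blast
  ultimately show ?thesis using root_iff by blast
qed

text \<open>The automorphism replaces \<alpha> by \<open>r\<close> in polynomial expressions.
  Freeness over \<open>K\<close> makes this well defined, and \<beta> in K(\<alpha>) puts all four
  roots into the field.\<close>

lemma exists_aut:
  assumes free: "cubic_free K \<alpha>" and beta: "\<beta> \<in> adjoin R K \<alpha>" and r: "r \<in> {\<alpha>, \<ominus> \<alpha>, \<beta>, \<ominus> \<beta>}"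
  shows "\<exists>f\<in>carrier (aut_group R K (adjoin R K \<alpha>)). f \<alpha> = r"
proof -
  let ?L = "adjoin R K \<alpha>" and ?P = "[\<one>, \<zero>, u, \<zero>, w]"
  have L: "subfield ?L R" and KL: "K \<subseteq> ?L" and aL: "\<alpha> \<in> ?L" using adjoin_subfield[OF K mem(1)] by auto
  note L' = subringE[OF subfieldE(1)[OF L]] and K' = subringE[OF subfieldE(1)[OF K]]
  have rL: "r \<in> ?L" using r aL beta L'(5) by auto
  have rc: "r \<in> carrier R" using rL L'(1) by blast
  interpret A: ring_hom_ring "K[X]" R "\<lambda>p. eval p \<alpha>" by (rule eval_ring_hom[OF subfieldE(1)[OF K] mem(1)])
  interpret B: ring_hom_ring "K[X]" R "\<lambda>p. eval p r" by (rule eval_ring_hom[OF subfieldE(1)[OF K] rc])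
  have img: "?L = (\<lambda>p. eval p \<alpha>) ` carrier (K[X])"
    using adjoin_eq_simple_extension[OF K mem(1) adjoin_algebraic[OF aL]]
      simple_extension_as_eval_img[OF K'(1) mem(1)] by simp
  have imgr: "eval p r \<in> ?L" if "p \<in> carrier (K[X])" for p
    using simple_extension_as_eval_img[OF K'(1) rc] that
      simple_extension_subring_incl[OF subfieldE(1)[OF L] KL rL] by blast
  \<comment> \<open>The remainder of \<open>p\<close> modulo the quartic is a cubic vanishing at
    \<alpha>, so by freeness all its coefficients are zero; hence \<open>p\<close> vanishes at every
    root.\<close>
  have ker: "eval p r = \<zero>" if p: "p \<in> carrier (K[X])" "eval p \<alpha> = \<zero>" for p
  proof -
    obtain s where s: "s \<in> carrier (K[X])" "length s < length ?P"
      "\<And>x. x \<in> carrier R \<Longrightarrow> eval ?P x = \<zero> \<Longrightarrow> eval p x = eval s x"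
      using eval_mod[OF K p(1) minpoly_in] by blast
    have "set s \<subseteq> K" "length s \<le> 4" using s(1,2) polynomial_incl by (auto simp: univ_poly_carrier)
    then obtain a b c d where abcd: "a \<in> K" "b \<in> K" "c \<in> K" "d \<in> K" 
      "\<And>x. x \<in> carrier R \<Longrightarrow> eval s x = cubic a b c d x" using eval_eq_cubic[OF K] by metis
    have "cubic a b c d \<alpha> = \<zero>"
      using abcd(5)[OF mem(1)] s(3)[OF mem(1)] eval_minpoly[OF mem(1)] p(2) by simp
    then have "a = \<zero>" "b = \<zero>" "c = \<zero>" "d = \<zero>" using cubic_freeD[OF free abcd(1-4)] by blast+
    then have "eval s r = \<zero>" using abcd(5)[OF rc] rc by (simp add: cubic_def)
    then show ?thesis using s(3)[OF rc] eval_minpoly[OF rc] r by simp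
  qed
  have well: "eval p r = eval q r" if pq: "p \<in> carrier (K[X])" "q \<in> carrier (K[X])" "eval p \<alpha> = eval q \<alpha>" for p q
  proof -
    have "eval (p \<ominus>\<^bsub>K[X]\<^esub> q) \<alpha> = \<zero>" using pq by (simp add: a_minus_def r_neg)
    then have "eval (p \<ominus>\<^bsub>K[X]\<^esub> q) r = \<zero>" using ker pq by simp
    then have "eval p r \<ominus> eval q r = \<zero>" using pq by (simp add: a_minus_def)
    then show ?thesis using pq by simp
  qed
  \<comment> \<open>Some polynomial with value \<open>x\<close> at \<alpha> is chosen; by
    \<open>well\<close> its value at \<open>r\<close> does not depend on the choice.\<close>
  define f where "f = (\<lambda>x\<in>?L. eval (SOME p. p \<in> carrier (K[X]) \<and> eval p \<alpha> = x) r)"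
  have f: "f (eval p \<alpha>) = eval p r" if p: "p \<in> carrier (K[X])" for p
  proof -
    let ?q = "SOME q. q \<in> carrier (K[X]) \<and> eval q \<alpha> = eval p \<alpha>"
    have "?q \<in> carrier (K[X]) \<and> eval ?q \<alpha> = eval p \<alpha>"
      by (rule someI[of _ p]) (use p in simp)
    then have "eval ?q r = eval p r" using well p by blast
    moreover have "eval p \<alpha> \<in> ?L" using img p by blast
    ultimately show ?thesis by (simp add: f_def)
  qed
  have closed: "f x \<in> ?L" if "x \<in> ?L" for x
  proof -
    obtain p where "p \<in> carrier (K[X])" "x = eval p \<alpha>" using \<open>x \<in> ?L\<close> img by blast
    then show ?thesis using f imgr by simp
  qed
  have mult: "f (x \<otimes> y) = f x \<otimes> f y" and add: "f (x \<oplus> y) = f x \<oplus> f y" if "x \<in> ?L" "y \<in> ?L" for x y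
  proof -
    obtain p where p: "p \<in> carrier (K[X])" "x = eval p \<alpha>" using \<open>x \<in> ?L\<close> img by blast
    obtain q where q: "q \<in> carrier (K[X])" "y = eval q \<alpha>" using \<open>y \<in> ?L\<close> img by blast
    show "f (x \<otimes> y) = f x \<otimes> f y"
      using f[of "p \<otimes>\<^bsub>K[X]\<^esub> q"] f[of p] f[of q] p q by simp
    show "f (x \<oplus> y) = f x \<oplus> f y"
      using f[of "p \<oplus>\<^bsub>K[X]\<^esub> q"] f[of p] f[of q] p q by simp
  qed
  have fixK: "f k = k" if k: "k \<in> K" for k
  proof -
    \<comment> \<open>The constant polynomial has to be normalized because for zero it is the empty
      list.\<close>
    have "polynomial K (normalize [k])" by (rule normalize_gives_polynomial) (use k in auto)
    then have "normalize [k] \<in> carrier (K[X])" by (simp only: univ_poly_carrier)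
    moreover have "eval (normalize [k]) x = k" if x: "x \<in> carrier R" for x
    proof -
      have kc: "k \<in> carrier R" using k K'(1) by blast
      then have "eval (normalize [k]) x = eval [k] x" by (intro eval_normalize x) auto
      also have "\<dots> = k" using kc x by simp
      finally show ?thesis .
    qed
    ultimately show ?thesis using f mem(1) rc by metis
  qed
  have fa: "f \<alpha> = r"
    using f[OF var_closed(1)[OF subfieldE(1)[OF K]]] eval_var mem(1) rc by simp
  have one: "f \<one> = \<one>" using fixK K'(3) by simp
  have zero: "f \<zero> = \<zero>" using fixK K'(2) by simp
  have inj: "inj_on f ?L"
  proof (rule inj_onI)
    fix x y assume xy: "x \<in> ?L" "y \<in> ?L" "f x = f y"
    have xyc: "x \<in> carrier R" "y \<in> carrier R" using xy L'(1) by auto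
    have d: "x \<ominus> y \<in> ?L" using xy L' by (simp add: a_minus_def)
    have "f (x \<ominus> y) \<oplus> f y = f x" using add[OF d xy(2)] xyc by (simp add: minus_eq a_assoc l_neg)
    then have z: "f (x \<ominus> y) = \<zero>"
      using xy(3) closed[OF d] closed[OF xy(2)] L'(1) by (metis add.r_cancel_one subsetD)
    show "x = y"
    proof (rule ccontr)
      assume "x \<noteq> y"
      then have n: "x \<ominus> y \<noteq> \<zero>" using xyc by simp
      \<comment> \<open>A nonzero element of the kernel would be invertible, and \<open>f\<close>
        would send its product with its inverse to zero instead of one.\<close>
      then have i: "inv (x \<ominus> y) \<in> ?L" "(x \<ominus> y) \<otimes> inv (x \<ominus> y) = \<one>"
        using subfield_inv_closed[OF L d] inv_cancel d L'(1) by auto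
      then have "\<one> = \<zero> \<otimes> f (inv (x \<ominus> y))" using mult[OF d i(1)] z one by simp
      then show False using closed[OF i(1)] L'(1) by auto
    qed
  qed
  let ?Z = "{\<alpha>, \<ominus> \<alpha>, \<beta>, \<ominus> \<beta>}"
  have ZL: "?Z \<subseteq> ?L" using aL beta L'(5) by auto
  \<comment> \<open>Surjectivity starts with the finite set of roots: \<open>f\<close> respects the
    quartic, so it maps the roots injectively into themselves and hence onto. The argument of
    \<open>aut_root\<close> is repeated since \<open>f\<close> is not yet known to be
    bijective.\<close>
  have "\<alpha> \<in> f ` ?Z"
  proof -
    have "f ` ?Z \<subseteq> ?Z"
    proof (rule image_subsetI)
      fix x assume x: "x \<in> ?Z"
      then have xL: "x \<in> ?L" using ZL by blast
      have uw: "u \<in> ?L" "w \<in> ?L" "f u = u" "f w = w" using mem FK KL fixK by auto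
      have "x \<otimes> x \<otimes> (x \<otimes> x) \<oplus> u \<otimes> (x \<otimes> x) \<oplus> w = \<zero>" using root_iff x xL L'(1) by blast
      moreover have "f (x \<otimes> x \<otimes> (x \<otimes> x) \<oplus> u \<otimes> (x \<otimes> x) \<oplus> w) =
          f x \<otimes> f x \<otimes> (f x \<otimes> f x) \<oplus> u \<otimes> (f x \<otimes> f x) \<oplus> w"
        using xL uw L'(6,7) by (simp add: mult add)
      ultimately have "f x \<otimes> f x \<otimes> (f x \<otimes> f x) \<oplus> u \<otimes> (f x \<otimes> f x) \<oplus> w = \<zero>"
        using zero by simp
      then show "f x \<in> ?Z" using root_iff closed[OF xL] L'(1) by blast
    qed
    then have "f ` ?Z = ?Z" using endo_inj_surj[of ?Z f] inj_on_subset[OF inj ZL] by simp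
    then show ?thesis by blast
  qed
  then obtain y where y: "y \<in> ?L" "f y = \<alpha>" using ZL by blast
  \<comment> \<open>Putting the preimage \<open>y\<close> of \<alpha> in place of \<alpha> in the
    coordinate expression of an element gives a preimage of that element.\<close>
  have "?L \<subseteq> f ` ?L"
  proof
    fix x assume "x \<in> ?L"
    then obtain a b c d where abcd: "a \<in> K" "b \<in> K" "c \<in> K" "d \<in> K" "x = cubic a b c d \<alpha>"
      by (rule adjoin_cubic)
    have abcdL: "a \<in> ?L" "b \<in> ?L" "c \<in> ?L" "d \<in> ?L" using abcd KL by auto
    have "f (cubic a b c d y) = x"
      using abcd abcdL y L'(6,7) unfolding cubic_def by (simp add: mult add fixK)
    moreover have "cubic a b c d y \<in> ?L" unfolding cubic_def using abcdL y L'(6,7) by simp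
    ultimately show "x \<in> f ` ?L" by blast
  qed
  then have "bij_betw f ?L ?L" using inj closed by (auto simp: bij_betw_def)
  moreover have "f \<in> extensional ?L" by (simp add: f_def)
  ultimately have "f \<in> carrier (aut_group R K ?L)"
    using aut_groupI[OF _ _ one mult add fixK] by blast
  then show ?thesis using fa by blast
qed

end

section \<open>Order and type of the automorphism group\<close>

lemma card_roots: "card {\<alpha>, \<ominus> \<alpha>, \<beta>, \<ominus> \<beta>} = 4"
  using distinct_card[OF roots_distinct(4)] by simp

context
  fixes K assumes K: "subfield K R" and FK: "F \<subseteq> K"
begin

text \<open>Evaluation at \<alpha> embeds the automorphisms into the four roots. Four automorphisms
  therefore reach \<beta>, and conversely \<beta> in the field makes every root reachable.\<close>

lemma card_aut_group_iff:
  assumes free: "cubic_free K \<alpha>"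
  shows "card (carrier (aut_group R K (adjoin R K \<alpha>))) = 4 \<longleftrightarrow> \<beta> \<in> adjoin R K \<alpha>"
proof -
  let ?L = "adjoin R K \<alpha>" and ?Z = "{\<alpha>, \<ominus> \<alpha>, \<beta>, \<ominus> \<beta>}"
  let ?G = "carrier (aut_group R K ?L)"
  have L: "subfield ?L R" and aL: "\<alpha> \<in> ?L" using adjoin_subfield[OF K mem(1)] by auto
  have inj: "inj_on (\<lambda>f. f \<alpha>) ?G" using aut_eqI[OF L refl] by (auto intro: inj_onI)
  have sub: "(\<lambda>f. f \<alpha>) ` ?G \<subseteq> ?Z" using aut_root[OF K FK _ aL] by blast
  show ?thesis
  proof
    assume "card ?G = 4"
    then have "(\<lambda>f. f \<alpha>) ` ?G = ?Z"
      using card_subset_eq[OF _ sub] card_image[OF inj] card_roots by simp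
    then have "\<beta> \<in> (\<lambda>f. f \<alpha>) ` ?G" by simp
    then obtain f where "f \<in> ?G" "f \<alpha> = \<beta>" by blast
    then show "\<beta> \<in> ?L" using aut_closed[OF L _ aL] by blast
  next
    assume "\<beta> \<in> ?L"
    have "?Z \<subseteq> (\<lambda>f. f \<alpha>) ` ?G"
    proof
      fix r assume "r \<in> ?Z"
      then obtain f where "f \<in> ?G" "f \<alpha> = r" using exists_aut[OF K FK free \<open>\<beta> \<in> ?L\<close>] by blast
      then show "r \<in> (\<lambda>f. f \<alpha>) ` ?G" by blast
    qed
    then have "(\<lambda>f. f \<alpha>) ` ?G = ?Z" by (rule subset_antisym[OF sub])
    then show "card ?G = 4" using card_image[OF inj] card_roots by simp
  qed
qed

lemma aut_cubic:
  assumes f: "f \<in> carrier (aut_group R K (adjoin R K \<alpha>))"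
    and "a \<in> K" "b \<in> K" "c \<in> K" "d \<in> K" "y \<in> adjoin R K \<alpha>"
  shows "f (cubic a b c d y) = cubic a b c d (f y)"
proof -
  let ?L = "adjoin R K \<alpha>"
  have L: "subfield ?L R" and KL: "K \<subseteq> ?L" using adjoin_subfield[OF K mem(1)] by auto
  have "a \<in> ?L" "b \<in> ?L" "c \<in> ?L" "d \<in> ?L" using assms(2-5) KL by auto
  then show ?thesis
    using subringE(6,7)[OF subfieldE(1)[OF L]] assms(2-6)
    by (simp add: cubic_def aut_mult[OF L f] aut_add[OF L f] aut_fix[OF L f])
qed

text \<open>Two automorphisms already cut the fixed field down to \<open>K\<close>: sending \<alpha>
  to its negative kills the odd coordinates, and sending \<alpha> to \<beta> then kills the
  quadratic one.\<close>

lemma galois_adjoin: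
  assumes free: "cubic_free K \<alpha>" and beta: "\<beta> \<in> adjoin R K \<alpha>"
  shows "galois_ext R K (adjoin R K \<alpha>)"
proof -
  let ?L = "adjoin R K \<alpha>"
  let ?G = "carrier (aut_group R K ?L)"
  have L: "subfield ?L R" and KL: "K \<subseteq> ?L" and aL: "\<alpha> \<in> ?L" using adjoin_subfield[OF K mem(1)] by auto
  note K' = subringE[OF subfieldE(1)[OF K]]
  have "x \<in> K" if x: "x \<in> ?L" and fixed: "\<And>f. f \<in> ?G \<Longrightarrow> f x = x" for x
  proof -
    obtain a b c d where abcd: "a \<in> K" "b \<in> K" "c \<in> K" "d \<in> K" "x = cubic a b c d \<alpha>"
      using adjoin_cubic[OF K FK x] by blast
    have carr: "a \<in> carrier R" "b \<in> carrier R" "c \<in> carrier R" "d \<in> carrier R"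
      using abcd K'(1) by auto
    obtain f where f: "f \<in> ?G" "f \<alpha> = \<ominus> \<alpha>" using exists_aut[OF K FK free beta] by blast
    obtain g where g: "g \<in> ?G" "g \<alpha> = \<beta>" using exists_aut[OF K FK free beta] by blast
    have eq: "cubic a b c d (\<ominus> \<alpha>) = cubic a b c d \<alpha>" "cubic a b c d \<beta> = cubic a b c d \<alpha>"
      using aut_cubic[OF f(1) abcd(1-4) aL] aut_cubic[OF g(1) abcd(1-4) aL] fixed[OF f(1)] fixed[OF g(1)]
        f(2) g(2) abcd(5) by simp_all
    \<comment> \<open>The difference of the values at \<alpha> and its negative is twice the odd
      part.\<close>
    have "cubic \<zero> (b \<oplus> b) \<zero> (d \<oplus> d) \<alpha> = cubic a b c d \<alpha> \<ominus> cubic a b c d (\<ominus> \<alpha>)"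
      unfolding cubic_def using carr mem(1) by algebra
    also have "\<dots> = \<zero>" unfolding eq using carr mem(1) by (simp add: cubic_def minus_eq r_neg)
    finally have "b \<oplus> b = \<zero>" "d \<oplus> d = \<zero>"
      using cubic_freeD(2,4)[OF free, of \<zero> "b \<oplus> b" \<zero> "d \<oplus> d"] abcd(2,4) K'(2,7) by blast+
    then have bd: "b = \<zero>" "d = \<zero>" using double_eq_zero carr by blast+
    \<comment> \<open>With the odd part gone, the values at \<alpha> and \<beta> differ by c times
      \<alpha>^2 - \<beta>^2, whose second factor is nonzero.\<close>
    have "c \<otimes> (\<alpha> \<otimes> \<alpha> \<ominus> \<beta> \<otimes> \<beta>) = cubic a b c d \<alpha> \<ominus> cubic a b c d \<beta>"
      unfolding cubic_def bd using carr mem(1,2) by algebra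
    also have "\<dots> = \<zero>" unfolding eq using carr mem(1) by (simp add: cubic_def minus_eq r_neg)
    finally have "c = \<zero>" using roots_distinct(3) carr mem(1,2) by (simp add: integral_iff)
    then have "x = a" using abcd(5) bd carr mem(1) by (simp add: cubic_def)
    then show "x \<in> K" using abcd(1) by simp
  qed
  moreover have "f x = x" if "x \<in> K" "f \<in> ?G" for x f using aut_fix[OF L that(2,1)] .
  ultimately have "{x \<in> ?L. \<forall>f\<in>?G. f x = x} = K" using KL by blast
  then show ?thesis
    using K L KL adjoin_algebraic[OF K FK] by (simp add: galois_ext_def field_ext_def)
qed

text \<open>Once there are four automorphisms, the two types differ in whether all of them square to
  the identity. This is decided by whether \<alpha>\<beta> lies in the fixed field
  \<open>K\<close>.\<close>

lemma galois_type_adjoin: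
  assumes free: "cubic_free K \<alpha>"
  shows "elementary_abelian_quartic_ext R K (adjoin R K \<alpha>) \<longleftrightarrow> \<alpha> \<otimes> \<beta> \<in> K"
    and "cyclic_quartic_ext R K (adjoin R K \<alpha>) \<longleftrightarrow> \<beta> \<in> adjoin R K \<alpha> \<and> \<alpha> \<otimes> \<beta> \<notin> K"
proof -
  let ?L = "adjoin R K \<alpha>"
  let ?G = "aut_group R K ?L"
  have L: "subfield ?L R" and KL: "K \<subseteq> ?L" and aL: "\<alpha> \<in> ?L" using adjoin_subfield[OF K mem(1)] by auto
  note L' = subringE[OF subfieldE(1)[OF L]]
  interpret G: group ?G by (rule group_aut_group[OF L KL])
  have quartic: "quartic_ext R K ?L"
    using cubic_free_iff_ext_degree[OF K FK] free K L KL by (simp add: quartic_ext_def field_ext_def)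
  \<comment> \<open>An automorphism is determined by its value at \<alpha>, so its square needs
    testing only there.\<close>
  have invol_iff: "f \<otimes>\<^bsub>?G\<^esub> f = \<one>\<^bsub>?G\<^esub> \<longleftrightarrow> f (f \<alpha>) = \<alpha>" if f: "f \<in> carrier ?G" for f
    using aut_eqI[OF L refl G.m_closed[OF f f] G.one_closed] aut_group_mult[OF f f aL]
      aut_group_one[OF aL, of K] by auto
  have invol_all_iff: "(\<forall>f\<in>carrier ?G. f (f \<alpha>) = \<alpha>) \<longleftrightarrow> \<alpha> \<otimes> \<beta> \<in> K" if beta: "\<beta> \<in> ?L"
  proof
    assume inv: "\<forall>f\<in>carrier ?G. f (f \<alpha>) = \<alpha>"
    \<comment> \<open>An involution with \<alpha> going to \<beta> up to sign sends \<beta> back to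
      \<alpha> with the same sign, and the two signs cancel in the product.\<close>
    have swap: "f (\<alpha> \<otimes> \<beta>) = \<alpha> \<otimes> \<beta>" if f: "f \<in> carrier ?G" "f \<alpha> = \<beta> \<or> f \<alpha> = \<ominus> \<beta>" for f
    proof -
      have ff: "f (f \<alpha>) = \<alpha>" using inv f(1) by blast
      have mult: "f (\<alpha> \<otimes> \<beta>) = f \<alpha> \<otimes> f \<beta>" using aut_mult[OF L f(1) aL beta] .
      from f(2) show ?thesis
      proof
        assume "f \<alpha> = \<beta>"
        then show ?thesis using mult ff mem by (simp add: m_comm)
      next
        assume fa: "f \<alpha> = \<ominus> \<beta>"
        then have "\<ominus> f \<beta> = \<alpha>" using ff aut_minus[OF L f(1) beta] by simp
        moreover have "f \<beta> \<in> carrier R" using aut_closed[OF L f(1) beta] L'(1) by blast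
        ultimately have "f \<beta> = \<ominus> \<alpha>" by auto
        then have "f (\<alpha> \<otimes> \<beta>) = \<ominus> \<beta> \<otimes> \<ominus> \<alpha>" using mult fa by simp
        also have "\<dots> = \<alpha> \<otimes> \<beta>" using mem(1,2) by algebra
        finally show ?thesis .
      qed
    qed
    have etaL: "\<alpha> \<otimes> \<beta> \<in> ?L" using aL beta L'(6) by simp
    have "f (\<alpha> \<otimes> \<beta>) = \<alpha> \<otimes> \<beta>" if f: "f \<in> carrier ?G" for f
    proof -
      obtain g where g: "g \<in> carrier ?G" "g \<alpha> = \<beta>" using exists_aut[OF K FK free beta] by blast
      consider "f \<alpha> = \<alpha>" | "f \<alpha> = \<ominus> \<alpha>" | "f \<alpha> = \<beta> \<or> f \<alpha> = \<ominus> \<beta>"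
        using aut_root[OF K FK f aL] by blast
      then show ?thesis
      proof cases
        case 1
        then have "f = \<one>\<^bsub>?G\<^esub>"
          using aut_eqI[OF L refl f G.one_closed] aut_group_one[OF aL, of K] by simp
        then show ?thesis using aut_group_one[OF etaL, of K] by simp
      next
        case 2
        \<comment> \<open>\<open>g\<close> and \<open>g \<circ> f\<close> both move \<open>\<alpha>\<close> to \<open>\<plusminus>\<beta>\<close>, so both fix \<open>\<alpha>\<beta>\<close>.\<close>
        let ?h = "g \<otimes>\<^bsub>?G\<^esub> f"
        have h: "?h \<in> carrier ?G" using f g(1) by simp
        have "?h \<alpha> = \<ominus> \<beta>"
          using aut_group_mult[OF g(1) f aL] 2 aut_minus[OF L g(1) aL] g(2) by simp
        then have "?h (\<alpha> \<otimes> \<beta>) = \<alpha> \<otimes> \<beta>" using swap[OF h] by blast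
        then have "g (f (\<alpha> \<otimes> \<beta>)) = g (\<alpha> \<otimes> \<beta>)"
          using aut_group_mult[OF g(1) f etaL] swap[OF g(1)] g(2) by simp
        then show ?thesis using aut_inj[OF L g(1)] aut_closed[OF L f etaL] etaL by (auto dest: inj_onD)
      next
        case 3
        then show ?thesis using swap f by blast
      qed
    qed
    then show "\<alpha> \<otimes> \<beta> \<in> K"
      using galois_adjoin[OF free beta] etaL unfolding galois_ext_def by blast
  next
    assume eta: "\<alpha> \<otimes> \<beta> \<in> K"
    show "\<forall>f\<in>carrier ?G. f (f \<alpha>) = \<alpha>"
    proof
      fix f assume f: "f \<in> carrier ?G"
      have fc: "f \<beta> \<in> carrier R" using aut_closed[OF L f beta] L'(1) by blast
      \<comment> \<open>Since the product is fixed, the value at \<alpha> determines the value at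
        \<beta>.\<close>
      have prod: "f \<alpha> \<otimes> f \<beta> = \<alpha> \<otimes> \<beta>" using aut_mult[OF L f aL beta] aut_fix[OF L f eta] by simp
      have neg: "\<ominus> x \<otimes> y = x \<otimes> \<ominus> y" if "x \<in> carrier R" "y \<in> carrier R" for x y
        using that by algebra
      consider "f \<alpha> = \<alpha>" | "f \<alpha> = \<ominus> \<alpha>" | "f \<alpha> = \<beta>" | "f \<alpha> = \<ominus> \<beta>"
        using aut_root[OF K FK f aL] by blast
      then show "f (f \<alpha>) = \<alpha>"
      proof cases
        case 1
        then show ?thesis by simp
      next
        case 2
        then show ?thesis using aut_minus[OF L f aL] mem(1) by simp
      next
        case 3
        then have "\<beta> \<otimes> f \<beta> = \<beta> \<otimes> \<alpha>" using prod mem by (simp add: m_comm)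
        then have "f \<beta> = \<alpha>" using m_lcancel[OF roots_distinct(2) mem(2) fc mem(1)] by simp
        then show ?thesis using 3 by simp
      next
        case 4
        then have "\<beta> \<otimes> (\<ominus> f \<beta>) = \<beta> \<otimes> \<alpha>" using prod mem fc neg by (simp add: m_comm)
        then have "\<ominus> f \<beta> = \<alpha>" using m_lcancel[OF roots_distinct(2) mem(2) _ mem(1)] fc by simp
        then show ?thesis using 4 aut_minus[OF L f beta] by simp
      qed
    qed
  qed
  \<comment> \<open>Dividing by \<alpha> shows that in the elementary abelian case \<beta> lies in
    K(\<alpha>) automatically.\<close>
  have eta_beta: "\<beta> \<in> ?L" if "\<alpha> \<otimes> \<beta> \<in> K"
    using alpha_beta_in_iff[OF L aL] that KL by blast
  show "elementary_abelian_quartic_ext R K ?L \<longleftrightarrow> \<alpha> \<otimes> \<beta> \<in> K"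
    unfolding elementary_abelian_quartic_ext_def G.iso_klein4_iff
    using quartic card_aut_group_iff[OF free] galois_adjoin[OF free] eta_beta invol_all_iff invol_iff by blast
  show "cyclic_quartic_ext R K ?L \<longleftrightarrow> \<beta> \<in> ?L \<and> \<alpha> \<otimes> \<beta> \<notin> K"
    unfolding cyclic_quartic_ext_def G.iso_cyclic4_iff
    using quartic card_aut_group_iff[OF free] galois_adjoin[OF free] invol_all_iff invol_iff by blast
qed

end

text \<open>The compositum is K(\<alpha>), and the degree condition in
  \<open>elementary_abelian_quartic_ext\<close> amounts to freeness over \<open>K\<close>; what
  remains is the criterion for the Galois type.\<close>

lemma elementary_abelian_over_iff:
  "elementary_abelian_over R F (adjoin R F \<alpha>) K \<longleftrightarrow>
     subfield K R \<and> F \<subseteq> K \<and> cubic_free K \<alpha> \<and> \<alpha> \<otimes> \<beta> \<in> K"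
proof (cases "subfield K R \<and> F \<subseteq> K")
  case True
  then have K: "subfield K R" and FK: "F \<subseteq> K" by auto
  have comp: "compositum R (adjoin R F \<alpha>) K = adjoin R K \<alpha>"
    using compositum_adjoin[OF F K FK mem(1)] .
  have "elementary_abelian_quartic_ext R K (adjoin R K \<alpha>) \<Longrightarrow> cubic_free K \<alpha>"
    using cubic_free_iff_ext_degree[OF K FK]
    by (simp add: elementary_abelian_quartic_ext_def quartic_ext_def)
  then show ?thesis
    using galois_type_adjoin(1)[OF K FK] F K FK
    by (auto simp: elementary_abelian_over_def field_ext_def comp)
next
  case False
  then show ?thesis by (auto simp: elementary_abelian_over_def field_ext_def)
qed

end

section \<open>Elementary abelian closures\<close>

context biquadratic
begin

section \<open>The field generated by a square root of w\<close>

lemma prod_roots_adjoin: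
  "\<alpha> \<otimes> \<beta> \<in> carrier R" "subfield (adjoin R F (\<alpha> \<otimes> \<beta>)) R" "F \<subseteq> adjoin R F (\<alpha> \<otimes> \<beta>)"
  "\<alpha> \<otimes> \<beta> \<in> adjoin R F (\<alpha> \<otimes> \<beta>)"
  using mem adjoin_subfield[OF F, of "\<alpha> \<otimes> \<beta>"] by auto

lemma prod_roots_poly:
  "[\<one>, \<zero>, \<ominus> w] \<in> carrier (F[X])" "eval [\<one>, \<zero>, \<ominus> w] (\<alpha> \<otimes> \<beta>) = \<zero>"
proof -
  have "set [\<one>, \<zero>, \<ominus> w] \<subseteq> F"
    using subringE(2,3,5)[OF subfieldE(1)[OF F]] mem(4) by auto
  then have "polynomial F [\<one>, \<zero>, \<ominus> w]" by (simp add: polynomial_def)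
  then show "[\<one>, \<zero>, \<ominus> w] \<in> carrier (F[X])" by (simp only: univ_poly_carrier)
  have "eval [\<one>, \<zero>, \<ominus> w] (\<alpha> \<otimes> \<beta>) = \<alpha> \<otimes> \<beta> \<otimes> (\<alpha> \<otimes> \<beta>) \<oplus> \<ominus> w"
    using prod_roots_adjoin(1) coeffs_carrier by (simp add: numeral_2_eq_2)
  then show "eval [\<one>, \<zero>, \<ominus> w] (\<alpha> \<otimes> \<beta>) = \<zero>"
    using root_prod coeffs_carrier by (simp add: r_neg)
qed

text \<open>Remainders modulo X^2 - w have at most two coefficients. The pair is not claimed to be
  unique, so the case of \<alpha>\<beta> in \<open>F\<close> is included.\<close>

lemma adjoin_prod_roots:
  assumes "y \<in> adjoin R F (\<alpha> \<otimes> \<beta>)"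
  obtains a b where "a \<in> F" "b \<in> F" "y = a \<oplus> \<alpha> \<otimes> \<beta> \<otimes> b"
proof -
  note F' = subringE[OF subfieldE(1)[OF F]]
  obtain r where r: "r \<in> carrier (F[X])" "length r < length [\<one>, \<zero>, \<ominus> w]" "y = eval r (\<alpha> \<otimes> \<beta>)"
    using adjoin_eval[OF F prod_roots_adjoin(1) prod_roots_poly(1) _ prod_roots_poly(2) assms] by blast
  have rF: "set r \<subseteq> F" using r(1) polynomial_incl by (simp add: univ_poly_carrier)
  consider "r = []" | a where "r = [a]" | a b where "r = [b, a]"
    using r(2) by (cases r; cases "tl r") (auto simp: Suc_le_eq less_Suc_eq length_Suc_conv)
  then show thesis
  proof cases
    case 1
    then show thesis using that[of \<zero> \<zero>] r(3) F'(2) prod_roots_adjoin(1) by simp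
  next
    case (2 a)
    then have "a \<in> F" "a \<in> carrier R" using rF F'(1) by auto
    then show thesis using that[of a \<zero>] r(3) 2 F'(2) prod_roots_adjoin(1) by simp
  next
    case (3 a b)
    then have ab: "a \<in> F" "b \<in> F" "a \<in> carrier R" "b \<in> carrier R" using rF F'(1) by auto
    have "y = b \<otimes> (\<alpha> \<otimes> \<beta>) \<oplus> a" using r(3) 3 ab prod_roots_adjoin(1) by simp
    also have "\<dots> = a \<oplus> \<alpha> \<otimes> \<beta> \<otimes> b" using ab mem(1,2) by algebra
    finally show thesis using that ab(1,2) by blast
  qed
qed

text \<open>If \<alpha>\<beta> lies in F(\<alpha>), its coordinates there give a cubic relation over
  F(\<alpha>\<beta>). If it lies outside F(\<alpha>), each relation over F(\<alpha>\<beta>) splits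
  into two relations over \<open>F\<close>.\<close>

lemma cubic_free_adjoin_iff:
  "cubic_free (adjoin R F (\<alpha> \<otimes> \<beta>)) \<alpha> \<longleftrightarrow> \<alpha> \<otimes> \<beta> \<in> F \<or> \<alpha> \<otimes> \<beta> \<notin> adjoin R F \<alpha>"
proof -
  let ?E = "adjoin R F (\<alpha> \<otimes> \<beta>)" and ?L = "adjoin R F \<alpha>" and ?e = "\<alpha> \<otimes> \<beta>"
  note E = subringE[OF subfieldE(1)[OF prod_roots_adjoin(2)]] and F' = subringE[OF subfieldE(1)[OF F]]
  have L: "subfield ?L R" and FL: "F \<subseteq> ?L" and aL: "\<alpha> \<in> ?L" using adjoin_subfield[OF F mem(1)] by auto
  note L' = subringE[OF subfieldE(1)[OF L]]
  show ?thesis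
  proof
    assume freeE: "cubic_free ?E \<alpha>"
    show "?e \<in> F \<or> ?e \<notin> ?L"
    proof (rule ccontr)
      assume neg: "\<not> (?e \<in> F \<or> ?e \<notin> ?L)"
      then obtain a b c d where abcd: "a \<in> F" "b \<in> F" "c \<in> F" "d \<in> F" "?e = cubic a b c d \<alpha>"
        using adjoin_cubic[OF F order_refl, of ?e] by blast
      have carr: "a \<in> carrier R" "b \<in> carrier R" "c \<in> carrier R" "d \<in> carrier R"
        using abcd(1-4) F'(1) by auto
      have inE: "a \<in> ?E" "b \<in> ?E" "c \<in> ?E" "d \<in> ?E" "a \<oplus> \<ominus> ?e \<in> ?E"
        using abcd(1-4) prod_roots_adjoin(3,4) E(5,7) by auto
      \<comment> \<open>Moving \<alpha>\<beta> into the constant coefficient gives a relation over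
        F(\<alpha>\<beta>); its constant term must vanish, so \<alpha>\<beta> would equal
        \<open>a\<close> in \<open>F\<close>.\<close>
      have "cubic (a \<oplus> \<ominus> ?e) b c d \<alpha> = cubic a b c d \<alpha> \<oplus> \<ominus> ?e"
        unfolding cubic_def using carr mem(1,2) by algebra
      also have "\<dots> = \<zero>" unfolding abcd(5)[symmetric] using prod_roots_adjoin(1) by (rule r_neg)
      finally have "a \<oplus> \<ominus> ?e = \<zero>" using cubic_freeD(1)[OF freeE inE(5,2,3,4)] by blast
      then have "?e = a" using carr(1) prod_roots_adjoin(1) by (metis r_right_minus_eq a_minus_def)
      then show False using neg abcd(1) by simp
    qed
  next
    assume "?e \<in> F \<or> ?e \<notin> ?L"
    then show "cubic_free ?E \<alpha>"
    proof
      assume "?e \<in> F"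
      then have "?E = F" using adjoin_minimal[OF F order_refl, of ?e] prod_roots_adjoin(3) by blast
      then show ?thesis using free by simp
    next
      assume notin: "?e \<notin> ?L"
      show ?thesis unfolding cubic_free_def
      proof (intro ballI impI)
        fix a b c d assume "a \<in> ?E" "b \<in> ?E" "c \<in> ?E" "d \<in> ?E" and zero: "cubic a b c d \<alpha> = \<zero>"
        then obtain a0 a1 b0 b1 c0 c1 d0 d1
          where a: "a0 \<in> F" "a1 \<in> F" "a = a0 \<oplus> ?e \<otimes> a1" and b: "b0 \<in> F" "b1 \<in> F" "b = b0 \<oplus> ?e \<otimes> b1"
            and c: "c0 \<in> F" "c1 \<in> F" "c = c0 \<oplus> ?e \<otimes> c1" and d: "d0 \<in> F" "d1 \<in> F" "d = d0 \<oplus> ?e \<otimes> d1"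
          using adjoin_prod_roots by metis
        let ?p = "cubic a0 b0 c0 d0 \<alpha>" and ?q = "cubic a1 b1 c1 d1 \<alpha>"
        have carr: "a0 \<in> carrier R" "b0 \<in> carrier R" "c0 \<in> carrier R" "d0 \<in> carrier R"
          "a1 \<in> carrier R" "b1 \<in> carrier R" "c1 \<in> carrier R" "d1 \<in> carrier R"
          using a b c d F'(1) by auto
        have cubicL: "cubic x y z t \<alpha> \<in> ?L" if "x \<in> F" "y \<in> F" "z \<in> F" "t \<in> F" for x y z t
        proof -
          have "x \<in> ?L" "y \<in> ?L" "z \<in> ?L" "t \<in> ?L" using that FL by auto
          then show ?thesis unfolding cubic_def using aL L'(6,7) by simp
        qed
        have pL: "?p \<in> ?L" and qL: "?q \<in> ?L" using a b c d cubicL by blast+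
        have pc: "?p \<in> carrier R" and qc: "?q \<in> carrier R" using pL qL L'(1) by auto
        \<comment> \<open>The relation is sorted into a part without \<alpha>\<beta> and a multiple
          of \<alpha>\<beta>, both cofactors lying in F(\<alpha>).\<close>
        have "?p \<oplus> ?e \<otimes> ?q = cubic a b c d \<alpha>"
          unfolding a(3) b(3) c(3) d(3) cubic_def using carr mem(1,2) by algebra
        then have sum: "?p \<oplus> ?e \<otimes> ?q = \<zero>" using zero by simp
        have q0: "?q = \<zero>"
        proof (rule ccontr)
          assume nz: "?q \<noteq> \<zero>"
          \<comment> \<open>A nonzero \<open>?q\<close> could be divided out, which would put
            \<alpha>\<beta> into F(\<alpha>).\<close>
          have "?e \<otimes> ?q = \<ominus> ?p" using sum pc qc prod_roots_adjoin(1)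
            by (metis a_comm m_closed minus_equality)
          then have "?q \<otimes> ?e \<in> ?L" using pL L'(5) qc prod_roots_adjoin(1) by (simp add: m_comm)
          then show False
            using subfield_m_inv_simprule[OF L, of ?q ?e] qL nz prod_roots_adjoin(1) notin by blast
        qed
        then have "?p = \<zero>" using sum pc prod_roots_adjoin(1) by simp
        then have "a0 = \<zero>" "b0 = \<zero>" "c0 = \<zero>" "d0 = \<zero>"
          using cubic_freeD[OF free a(1) b(1) c(1) d(1)] by blast+
        moreover have "a1 = \<zero>" "b1 = \<zero>" "c1 = \<zero>" "d1 = \<zero>"
          using cubic_freeD[OF free a(2) b(2) c(2) d(2) q0] by blast+
        ultimately show "a = \<zero> \<and> b = \<zero> \<and> c = \<zero> \<and> d = \<zero>"
          using a(3) b(3) c(3) d(3) prod_roots_adjoin(1) by simp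
      qed
    qed
  qed
qed

text \<open>Every competitor contains F(\<alpha>\<beta>), and freeness descends from it to
  F(\<alpha>\<beta>). So as soon as any competitor exists, F(\<alpha>\<beta>) is the least one for
  inclusion, and its finite degree makes it the only one of least degree.\<close>

lemma elementary_abelian_closure_iff:
  "elementary_abelian_closure R F (adjoin R F \<alpha>) E \<longleftrightarrow>
     E = adjoin R F (\<alpha> \<otimes> \<beta>) \<and> cubic_free (adjoin R F (\<alpha> \<otimes> \<beta>)) \<alpha>"
proof -
  let ?E = "adjoin R F (\<alpha> \<otimes> \<beta>)"
  have least: "?E \<subseteq> K" "cubic_free ?E \<alpha>" "elementary_abelian_over R F (adjoin R F \<alpha>) ?E"
    if "elementary_abelian_over R F (adjoin R F \<alpha>) K" for K
  proof -
    have K: "subfield K R" "F \<subseteq> K" "cubic_free K \<alpha>" "\<alpha> \<otimes> \<beta> \<in> K"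
      using that by (simp_all add: elementary_abelian_over_iff)
    show sub: "?E \<subseteq> K" using adjoin_minimal[OF K(1,2,4)] .
    then show "cubic_free ?E \<alpha>" using K(3) unfolding cubic_free_def by blast
    then show "elementary_abelian_over R F (adjoin R F \<alpha>) ?E"
      using prod_roots_adjoin by (simp add: elementary_abelian_over_iff)
  qed
  \<comment> \<open>Finiteness is essential for uniqueness: comparing infinite values of
    \<open>ext_degree\<close> would not force two nested fields to coincide.\<close>
  have fin: "finite_dimension F ?E"
    using finite_dimension_simple_extension[OF F prod_roots_adjoin(1)] adjoin_eq_simple_extension[OF F prod_roots_adjoin(1)]
      algebraicI[OF prod_roots_poly(1) _ prod_roots_poly(2)] by simp
  show ?thesis
  proof
    assume clo: "elementary_abelian_closure R F (adjoin R F \<alpha>) E"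
    then have over: "elementary_abelian_over R F (adjoin R F \<alpha>) E"
      by (simp add: elementary_abelian_closure_def)
    have le: "ext_degree R F E \<le> ext_degree R F ?E"
      using clo least(3)[OF over] unfolding elementary_abelian_closure_def by blast
    have sf: "subfield E R" using over by (simp add: elementary_abelian_over_iff)
    then show "E = ?E \<and> cubic_free ?E \<alpha>"
      using ext_degree_mono(2)[OF F prod_roots_adjoin(2) sf prod_roots_adjoin(3) least(1)[OF over] fin le] least(2)[OF over]
      by simp
  next
    assume E: "E = ?E \<and> cubic_free ?E \<alpha>"
    then have over: "elementary_abelian_over R F (adjoin R F \<alpha>) ?E"
      using prod_roots_adjoin by (simp add: elementary_abelian_over_iff)
    moreover have "ext_degree R F ?E \<le> ext_degree R F K"
      if K: "elementary_abelian_over R F (adjoin R F \<alpha>) K" for K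
    proof -
      have "subfield K R" using K by (simp add: elementary_abelian_over_iff)
      then show ?thesis using ext_degree_mono(1)[OF F prod_roots_adjoin(2) _ prod_roots_adjoin(3) least(1)[OF K]] by blast
    qed
    ultimately show "elementary_abelian_closure R F (adjoin R F \<alpha>) E"
      using E by (simp add: elementary_abelian_closure_def)
  qed
qed

end

section \<open>Square roots in the algebraic closure, and the final statement\<close>

lemma (in algebraically_closed) exists_square_root:
  assumes x: "x \<in> carrier L"
  obtains y where "y \<in> carrier L" "y \<otimes> y = x"
proof -
  let ?p = "[\<one>, \<zero>, \<ominus> x]"
  have "set ?p \<subseteq> carrier L" using x by simp
  then have "polynomial (carrier L) ?p" by (simp add: polynomial_def)
  then have p: "?p \<in> carrier (poly_ring L)" by (simp only: univ_poly_carrier)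
  \<comment> \<open>\<open>splitted\<close> says that the number of roots with multiplicity equals
    the degree, so the multiset of roots is nonempty.\<close>
  have "size (roots ?p) = 2" using roots_over_carrier[OF p] by (simp add: splitted_def)
  then obtain y where "y \<in># roots ?p" by (metis size_eq_Suc_imp_elem numeral_2_eq_2)
  then have y: "y \<in> carrier L" "eval ?p y = \<zero>"
    using roots_mem_iff_is_root[OF p] by (auto simp: is_root_def)
  have "eval ?p y = y \<otimes> y \<oplus> \<ominus> x" using y(1) x by (simp add: numeral_2_eq_2)
  then have "y \<otimes> y = x" using y x by (metis m_closed r_right_minus_eq a_minus_def)
  then show thesis using that y(1) by blast
qed

text \<open>Here \<open>L\<close> is the ambient field, \<open>K\<close> the base field and
  \<open>M\<close> the quartic extension. Choosing \<beta> as a square root of -u - \<alpha>^2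
  secures the first of Vieta's formulas; the second follows from the quartic equation for
  \<alpha>.\<close>

lemma (in algebraic_closure) biquadratic_generatorE:
  assumes char: "\<one> \<oplus> \<one> \<noteq> \<zero>" and gen: "biquadratic_generator L K M \<alpha> u w"
    and M: "M \<subseteq> carrier L"
  obtains \<beta> where "biquadratic L K \<alpha> \<beta> u w"
proof -
  have alpha: "\<alpha> \<in> carrier L" and uw: "u \<in> K" "w \<in> K" and irr: "Irr K \<alpha> = [\<one>, \<zero>, u, \<zero>, w]"
    using gen M by (auto simp: biquadratic_generator_def)
  have uwc: "u \<in> carrier L" "w \<in> carrier L" using uw subfieldE(3)[OF subfield_axioms] by auto
  note Irr = IrrE[OF subfield_axioms alpha algebraic_extension[OF alpha]]
  have "eval (Irr K \<alpha>) \<alpha> = \<alpha> \<otimes> \<alpha> \<otimes> (\<alpha> \<otimes> \<alpha>) \<oplus> u \<otimes> (\<alpha> \<otimes> \<alpha>) \<oplus> w"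
    unfolding irr using alpha uwc by (simp add: numeral_eq_Suc m_assoc a_assoc)
  then have root: "\<alpha> \<otimes> \<alpha> \<otimes> (\<alpha> \<otimes> \<alpha>) \<oplus> u \<otimes> (\<alpha> \<otimes> \<alpha>) \<oplus> w = \<zero>" using Irr(4) by simp
  have "ext_degree L K (adjoin L K \<alpha>) = 4"
  proof -
    have alg: "(algebraic over K) \<alpha>" by (rule algebraic_extension[OF alpha])
    show ?thesis
      using finite_dimension_simple_extension[OF subfield_axioms alpha] alg
        simple_extension_dim[OF subfield_axioms alpha alg]
        adjoin_eq_simple_extension[OF subfield_axioms alpha alg] irr
      by (simp add: ext_degree_def over_def numeral_eq_enat)
  qed
  then have free: "cubic_free K \<alpha>"
    using cubic_free_iff_degree[OF subfield_axioms alpha Irr(1) _ Irr(4)] irr by simp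
  obtain \<beta> where beta: "\<beta> \<in> carrier L" "\<beta> \<otimes> \<beta> = \<ominus> u \<ominus> \<alpha> \<otimes> \<alpha>"
    using exists_square_root[of "\<ominus> u \<ominus> \<alpha> \<otimes> \<alpha>"] alpha uwc by auto
  have sum: "\<alpha> \<otimes> \<alpha> \<oplus> \<beta> \<otimes> \<beta> = \<ominus> u" unfolding beta(2) using alpha uwc by algebra
  have "\<alpha> \<otimes> \<beta> \<otimes> (\<alpha> \<otimes> \<beta>) = \<alpha> \<otimes> \<alpha> \<otimes> (\<beta> \<otimes> \<beta>)" using alpha beta(1) by algebra
  \<comment> \<open>The product of \<alpha>^2 and -u - \<alpha>^2 is \<open>w\<close> minus the
    value of the quartic at \<alpha>, which is zero.\<close>
  also have "\<dots> = w \<ominus> (\<alpha> \<otimes> \<alpha> \<otimes> (\<alpha> \<otimes> \<alpha>) \<oplus> u \<otimes> (\<alpha> \<otimes> \<alpha>) \<oplus> w)"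
    unfolding beta(2) using alpha uwc by algebra
  also have "\<dots> = w" unfolding root using uwc by (simp add: minus_eq)
  finally have "biquadratic L K \<alpha> \<beta> u w"
    using alpha beta(1) uw sum free char subfield_axioms
    by unfold_locales auto
  then show thesis by (rule that)
qed

theorem lemma3p20:
  fixes Fbar :: "('a, 'b) ring_scheme" and F L :: "'a set" and \<alpha> u w :: 'a
  assumes "algebraic_closure Fbar F"
    and "\<one>\<^bsub>Fbar\<^esub> \<oplus>\<^bsub>Fbar\<^esub> \<one>\<^bsub>Fbar\<^esub> \<noteq> \<zero>\<^bsub>Fbar\<^esub>"
    and "biquadratic_ext Fbar F L"
    and "biquadratic_generator Fbar F L \<alpha> u w"
  shows "(elementary_abelian_closure Fbar F L F \<longleftrightarrow> (\<exists>a\<in>F. w = a [^]\<^bsub>Fbar\<^esub> (2::nat))) \<and>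
    (\<forall>E. elementary_abelian_closure Fbar F L E \<longrightarrow>
       (\<exists>\<eta>\<in>carrier Fbar. \<eta> [^]\<^bsub>Fbar\<^esub> (2::nat) = w \<and> E = adjoin Fbar F \<eta>)) \<and>
    ((\<exists>E. elementary_abelian_closure Fbar F L E) \<longleftrightarrow> \<not> cyclic_quartic_ext Fbar F L)"
proof -
  interpret algebraic_closure Fbar F by (rule assms(1))
  have "L \<subseteq> carrier Fbar"
    using assms(3) subfieldE(3) by (auto simp: biquadratic_ext_def quartic_ext_def field_ext_def)
  then obtain \<beta> where "biquadratic Fbar F \<alpha> \<beta> u w"
    using biquadratic_generatorE[OF assms(2,4)] by blast
  then interpret bq: biquadratic Fbar F \<alpha> \<beta> u w .
  let ?e = "\<alpha> \<otimes>\<^bsub>Fbar\<^esub> \<beta>"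
  have L: "L = adjoin Fbar F \<alpha>" using assms(4) by (simp add: biquadratic_generator_def)
  note clo = bq.elementary_abelian_closure_iff[folded L]
  \<comment> \<open>The only possible closure is F(\<alpha>\<beta>), so triviality of the closure
    means that \<alpha>\<beta> lies in \<open>F\<close>; freeness then holds as well.\<close>
  have F_iff: "F = adjoin Fbar F ?e \<longleftrightarrow> ?e \<in> F"
    using bq.prod_roots_adjoin(3,4) adjoin_minimal[OF bq.F order_refl, of ?e] by blast
  have 1: "elementary_abelian_closure Fbar F L F \<longleftrightarrow> ?e \<in> F"
    using clo F_iff bq.cubic_free_adjoin_iff by blast
  have 2: "?e [^]\<^bsub>Fbar\<^esub> (2::nat) = w"
    using bq.root_prod bq.prod_roots_adjoin(1) by (simp add: numeral_2_eq_2)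
  have Lsub: "subfield L Fbar" "\<alpha> \<in> L"
    using adjoin_subfield[OF bq.F bq.mem(1)] L by auto
  \<comment> \<open>As \<alpha> is in \<open>L\<close>, membership of \<beta> and of \<alpha>\<beta>
    in \<open>L\<close> agree. The cyclic case thus becomes exactly the negation of the condition in
    \<open>cubic_free_adjoin_iff\<close>.\<close>
  have "cyclic_quartic_ext Fbar F L \<longleftrightarrow> ?e \<in> L \<and> ?e \<notin> F"
    using bq.galois_type_adjoin(2)[OF bq.F order_refl bq.free, folded L] bq.alpha_beta_in_iff[OF Lsub]
    by blast
  then have 3: "(\<exists>E. elementary_abelian_closure Fbar F L E) \<longleftrightarrow> \<not> cyclic_quartic_ext Fbar F L"
    using clo bq.cubic_free_adjoin_iff[folded L] by blast
  show ?thesis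
    using 1 2 3 clo bq.square_in_iff[OF bq.F] bq.prod_roots_adjoin(1) by blast
qed

end
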